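(* Let $\Pi$ be the plane $\{z=0\}$ in $\mathbb{R}^3$, let $C\subset\Pi$ be a simple closed curve bounding the bounded domain $\Omega\subset\Pi$, and let $\Sigma=C\times\mathbb{R}$ and $K=\Omega\times\mathbb{R}$. Let $S$ be a compact surface with boundary and let $\phi:S\to\mathbb{R}^3$ be a minimal immersion such that $\phi(S)\subset K$, $\phi(\partial S)\subset\Sigma$, and $\phi(S)$ meets $\Sigma$ at a constant angle along $\partial S$. If $\phi(\partial S)$ is a graph over $C$, then $\phi(S)$ is a horizontal planar domain (contained in a plane parallel to $\Pi$).
   Context: Coordinates $(x,y,z)$ on $\mathbb{R}^3$, with the $z$-axis vertical. A curve in $\Sigma$ is a graph over $C$ if it is of the form $\{(p,f(p)):p\in C\}$ for a function $f:C\to\mathbb{R}$, i.e. its vertical projection to $\Pi$ is a bijection onto $C$ (with nonvanishing derivative of the projection along the curve). *)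

theory Defs
  imports "HOL-Analysis.Analysis" "HOL-Analysis.Cross3"
begin

text \<open>C^k and C^infinity maps between normed spaces, on a set W (used with W open).\<close>
primrec Ck_on :: "nat \<Rightarrow> 'a::real_normed_vector set \<Rightarrow> ('a \<Rightarrow> 'b::real_normed_vector) \<Rightarrow> bool" where
  "Ck_on 0 W F = continuous_on W F"
| "Ck_on (Suc k) W F = (continuous_on W F \<and> (\<forall>x\<in>W. F differentiable (at x)) \<and>
      (\<forall>v. Ck_on k W (\<lambda>x. frechet_derivative F (at x) v)))"

definition smooth_on :: "'a::real_normed_vector set \<Rightarrow> ('a \<Rightarrow> 'b::real_normed_vector) \<Rightarrow> bool" where
  "smooth_on W F \<longleftrightarrow> (\<forall>k. Ck_on k W F)"

definition proj :: "real^3 \<Rightarrow> real^2" where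
  "proj q = vector [q$1, q$2]"

definition lift :: "real^2 \<Rightarrow> real \<Rightarrow> real^3" where
  "lift p z = vector [p$1, p$2, z]"

definition smooth_simple_closed_curve :: "(real \<Rightarrow> real^2) \<Rightarrow> bool" where
  "smooth_simple_closed_curve \<gamma> \<longleftrightarrow> smooth_on UNIV \<gamma> \<and> (\<forall>t. \<gamma> (t + 1) = \<gamma> t) \<and>
     inj_on \<gamma> {0..<1} \<and> (\<forall>t. vector_derivative \<gamma> (at t) \<noteq> 0)"

definition cyl_normal :: "(real \<Rightarrow> real^2) \<Rightarrow> real^3 \<Rightarrow> real^3" where
  "cyl_normal \<gamma> q = (let t = (SOME t. \<gamma> t = proj q); d = vector_derivative \<gamma> (at t) in
      (1 / norm d) *\<^sub>R vector [- (d$2), d$1, 0])"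

definition upper_half :: "(real \<times> real) set" where
  "upper_half = {p. snd p \<ge> 0}"

definition surface_chart :: "'a topology \<Rightarrow> 'a set \<Rightarrow> ('a \<Rightarrow> real \<times> real) \<Rightarrow> bool" where
  "surface_chart S U \<psi> \<longleftrightarrow> openin S U \<and> openin (top_of_set upper_half) (\<psi> ` U) \<and>
     homeomorphic_map (subtopology S U) (top_of_set (\<psi> ` U)) \<psi>"

definition pu :: "(real \<times> real \<Rightarrow> 'b::real_normed_vector) \<Rightarrow> real \<times> real \<Rightarrow> 'b" where
  "pu F p = frechet_derivative F (at p) (1, 0)"

definition pv :: "(real \<times> real \<Rightarrow> 'b::real_normed_vector) \<Rightarrow> real \<times> real \<Rightarrow> 'b" where
  "pv F p = frechet_derivative F (at p) (0, 1)"

definition unit_normal :: "(real \<times> real \<Rightarrow> real^3) \<Rightarrow> real \<times> real \<Rightarrow> real^3" where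
  "unit_normal F p = (1 / norm (cross3 (pu F p) (pv F p))) *\<^sub>R cross3 (pu F p) (pv F p)"

definition mean_curvature :: "(real \<times> real \<Rightarrow> real^3) \<Rightarrow> real \<times> real \<Rightarrow> real" where
  "mean_curvature F p =
    (let n = unit_normal F p;
         E = pu F p \<bullet> pu F p; Fm = pu F p \<bullet> pv F p; G = pv F p \<bullet> pv F p;
         e = pu (pu F) p \<bullet> n; f = pv (pu F) p \<bullet> n; g = pv (pv F) p \<bullet> n
     in (e * G - 2 * f * Fm + g * E) / (2 * (E * G - Fm\<^sup>2)))"

definition local_rep :: "('a \<Rightarrow> real^3) \<Rightarrow> 'a set \<Rightarrow> ('a \<Rightarrow> real \<times> real) \<Rightarrow>
     (real \<times> real) set \<Rightarrow> (real \<times> real \<Rightarrow> real^3) \<Rightarrow> bool" where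
  "local_rep \<phi> U \<psi> W F \<longleftrightarrow> open W \<and> \<psi> ` U \<subseteq> W \<and> smooth_on W F \<and> (\<forall>x\<in>U. F (\<psi> x) = \<phi> x)"

end

theory Submission
  imports Defs
begin

text \<open>Every linear function of the immersion solves, in each chart, a linear elliptic equation without
  zeroth order term, so the strong maximum principle and Hopf's boundary point lemma apply to it.
  A nonempty open and closed part of the surface therefore has boundary points, and a nonempty open
  and closed part of the boundary covers the whole curve C. On the boundary the height is a function
  of the projection to C. Let M and m be the maximum and the minimum of the height. If the height is
  locally constant at some point with value M or m, it has that value on an open and closed part of
  the surface, hence on all of the boundary, and M = m. Otherwise M and m are attained only on the
  boundary, and Hopf's lemma gives the vertical part of the conormal opposite strict signs at maxima
  and at minima. By the constant angle condition it then vanishes nowhere on the boundary, so the part of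
  the boundary where it has the sign seen at maxima is open and closed; it covers C and so contains a
  minimum, a contradiction.\<close>

section \<open>Elliptic equations in the plane\<close>

text \<open>The atlas consists of homeomorphisms with no compatibility between charts, so whatever
  must not depend on the chart (the boundary, its tangent, the side on which the surface lies) is
  recovered from the immersion common to all charts. The surface need not be connected, and only the
  image of its boundary is a graph, so several boundary points may lie over one point of C; this is
  why open and closed parts are followed instead of one parametrised boundary curve. The angle comes
  without a sign, since each chart orients the normal in its own way. What it controls is zeros: the
  conormal is the normal crossed with the boundary tangent, so its vertical part is, up to a nonzero
  factor, the cosine of the angle between the normal and \<open>cyl_normal\<close>. Hopf's lemma
  supplies the sign, and continuity carries it from maxima to minima. The equation has no zeroth
  order term because minimality makes the second order part of the Laplacian of the immersion
  tangential, hence a combination of first derivatives.\<close>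

lemma nonpos_derivative_of_local_max_right:
  fixes f :: "real \<Rightarrow> real"
  assumes "(f has_real_derivative d) (at 0)" "0 < e" "\<And>t. 0 < t \<Longrightarrow> t < e \<Longrightarrow> f t \<le> f 0"
  shows "d \<le> 0"
proof (rule ccontr)
  assume "\<not> d \<le> 0"
  then obtain \<delta> where \<delta>: "\<delta> > 0" "\<And>h. 0 < h \<Longrightarrow> h < \<delta> \<Longrightarrow> f 0 < f (0 + h)"
    using DERIV_pos_inc_right[OF assms(1)] by (metis not_le)
  define t where "t = min e \<delta> / 2"
  have "0 < t" "t < e" "t < \<delta>" using assms(2) \<delta>(1) by (auto simp: t_def)
  then show False using \<delta>(2)[of t] assms(3)[of t] by simp
qed

lemma second_derivative_nonpos_of_local_max:
  fixes g g' :: "real \<Rightarrow> real"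
  assumes e: "0 < e"
    and g: "\<And>t. \<bar>t\<bar> < e \<Longrightarrow> (g has_real_derivative g' t) (at t)"
    and g': "(g' has_real_derivative c) (at 0)"
    and max: "\<And>t. \<bar>t\<bar> < e \<Longrightarrow> g t \<le> g 0"
  shows "c \<le> 0"
proof (rule ccontr)
  assume "\<not> c \<le> 0"
  moreover have "g' 0 = 0"
    using DERIV_local_max[OF g e] max e by auto
  ultimately obtain \<delta> where \<delta>: "\<delta> > 0" "\<And>h. 0 < h \<Longrightarrow> h < \<delta> \<Longrightarrow> 0 < g' h"
    using DERIV_pos_inc_right[OF g'] by auto
  define t where "t = min e \<delta> / 2"
  have t: "0 < t" "t < e" "t < \<delta>" using e \<delta>(1) by (auto simp: t_def)
  obtain z where z: "0 < z" "z < t" "g t - g 0 = (t - 0) * g' z"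
    using MVT2[OF t(1), of g g'] g t by auto
  have "0 < g' z" using \<delta>(2) z t by auto
  then have "0 < t * g' z" using t by simp
  then show False using z(3) t max[of t] by simp
qed

lemma has_real_derivative_along_line:
  fixes u :: "real \<times> real \<Rightarrow> real"
  assumes "(u has_derivative (\<lambda>h. a * fst h + b * snd h)) (at (p + t *\<^sub>R v))"
  shows "((\<lambda>t. u (p + t *\<^sub>R v)) has_real_derivative (a * fst v + b * snd v)) (at t)"
proof -
  have "((\<lambda>t. p + t *\<^sub>R v) has_derivative (\<lambda>h. h *\<^sub>R v)) (at t)"
    by (auto intro!: derivative_eq_intros)
  from has_derivative_compose[OF this assms]
  show ?thesis unfolding has_field_derivative_def
    by (rule has_derivative_eq_rhs) (simp add: fun_eq_iff algebra_simps)
qed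

text \<open>Completing the square writes the operator as \<open>A\<close> times the second
  derivative along \<open>(1, - B / A)\<close> plus \<open>(A * C - B\<^sup>2) / A\<close> times the
  one along \<open>(0, 1)\<close>; both second derivatives are nonpositive at a maximum.\<close>

lemma elliptic_operator_nonpos_at_max:
  fixes w wx wy :: "real \<times> real \<Rightarrow> real" and A B C :: real
  assumes N: "open N" "p \<in> N"
    and w: "\<And>q. q \<in> N \<Longrightarrow> (w has_derivative (\<lambda>h. wx q * fst h + wy q * snd h)) (at q)"
    and wx: "(wx has_derivative (\<lambda>h. wxx * fst h + wxy * snd h)) (at p)"
    and wy: "(wy has_derivative (\<lambda>h. wxy * fst h + wyy * snd h)) (at p)"
    and max: "\<And>q. q \<in> N \<Longrightarrow> w q \<le> w p"
    and ell: "0 < A" "B\<^sup>2 < A * C"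
  shows "wx p = 0" "wy p = 0" "A * wxx - 2 * B * wxy + C * wyy \<le> 0"
proof -
  obtain e where e: "0 < e" "ball p e \<subseteq> N" using N openE by blast
  have along: "\<exists>d>0. \<forall>t. \<bar>t\<bar> < d \<longrightarrow> p + t *\<^sub>R v \<in> N" for v
  proof -
    have "p + t *\<^sub>R v \<in> N" if "\<bar>t\<bar> < e / (norm v + 1)" for t
    proof -
      have "\<bar>t\<bar> * (norm v + 1) < e"
        using that pos_less_divide_eq[of "norm v + 1" "\<bar>t\<bar>" e] by (auto simp: add_nonneg_pos)
      moreover have "\<bar>t\<bar> * norm v \<le> \<bar>t\<bar> * (norm v + 1)" by (intro mult_left_mono) auto
      ultimately have "p + t *\<^sub>R v \<in> ball p e" by (simp add: dist_norm)
      then show ?thesis using e(2) by blast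
    qed
    then show ?thesis by (intro exI[of _ "e / (norm v + 1)"]) (use e in \<open>auto simp: add_nonneg_pos\<close>)
  qed
  have first: "wx p * fst v + wy p * snd v = 0" for v
  proof -
    obtain d where d: "d > 0" "\<And>t. \<bar>t\<bar> < d \<Longrightarrow> p + t *\<^sub>R v \<in> N" using along by blast
    have "((\<lambda>t. w (p + t *\<^sub>R v)) has_real_derivative (wx p * fst v + wy p * snd v)) (at 0)"
      by (rule has_real_derivative_along_line) (use w N in simp)
    from DERIV_local_max[OF this d(1)] show ?thesis using d(2) max by auto
  qed
  show wx0: "wx p = 0" and wy0: "wy p = 0" using first[of "(1,0)"] first[of "(0,1)"] by auto
  have second: "wxx * (fst v)\<^sup>2 + 2 * wxy * fst v * snd v + wyy * (snd v)\<^sup>2 \<le> 0" for v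
  proof -
    obtain d where d: "d > 0" "\<And>t. \<bar>t\<bar> < d \<Longrightarrow> p + t *\<^sub>R v \<in> N" using along by blast
    let ?g' = "\<lambda>t. wx (p + t *\<^sub>R v) * fst v + wy (p + t *\<^sub>R v) * snd v"
    have "((\<lambda>t. wx (p + t *\<^sub>R v)) has_real_derivative (wxx * fst v + wxy * snd v)) (at 0)"
      by (rule has_real_derivative_along_line) (use wx in simp)
    moreover have "((\<lambda>t. wy (p + t *\<^sub>R v)) has_real_derivative (wxy * fst v + wyy * snd v)) (at 0)"
      by (rule has_real_derivative_along_line) (use wy in simp)
    ultimately have "(?g' has_real_derivative ((wxx * fst v + wxy * snd v) * fst v
        + (wxy * fst v + wyy * snd v) * snd v)) (at 0)"
      by (auto intro!: derivative_eq_intros)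
    then have "(wxx * fst v + wxy * snd v) * fst v + (wxy * fst v + wyy * snd v) * snd v \<le> 0"
      using second_derivative_nonpos_of_local_max[OF d(1), of "\<lambda>t. w (p + t *\<^sub>R v)" ?g']
        has_real_derivative_along_line[OF w] d(2) max by auto
    then show ?thesis by (simp add: algebra_simps power2_eq_square)
  qed
  have "A * wxx - 2 * B * wxy + C * wyy
      = A * (wxx * 1\<^sup>2 + 2 * wxy * 1 * (- B / A) + wyy * (- B / A)\<^sup>2) + (A * C - B\<^sup>2) / A * wyy"
    using ell by (simp add: field_simps power2_eq_square)
  also have "\<dots> \<le> 0"
  proof -
    have "A * (wxx * 1\<^sup>2 + 2 * wxy * 1 * (- B / A) + wyy * (- B / A)\<^sup>2) \<le> 0"
      using second[of "(1, - B / A)"] ell by (simp add: mult_nonneg_nonpos)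
    moreover have "(A * C - B\<^sup>2) / A * wyy \<le> 0"
      using second[of "(0, 1)"] ell by (intro mult_nonneg_nonpos) auto
    ultimately show ?thesis by linarith
  qed
  finally show "A * wxx - 2 * B * wxy + C * wyy \<le> 0" .
qed

text \<open>Determinant over trace is a lower bound for the smaller eigenvalue of the matrix with
  entries A, -B, C. By Cayley-Hamilton, trace times form minus determinant times squared length is
  the squared length of the image vector: the sum of squares in the proof.\<close>

lemma elliptic_form_lower_bound:
  fixes A B C X Y :: real
  assumes "0 < A" "B\<^sup>2 < A * C"
  shows "(A * C - B\<^sup>2) / (A + C) * (X\<^sup>2 + Y\<^sup>2) \<le> A * X\<^sup>2 - 2 * B * X * Y + C * Y\<^sup>2"
proof -
  have "0 < A * C" using assms(2) zero_le_power2[of B] by linarith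
  then have "0 < C" using assms(1) by (simp add: zero_less_mult_iff)
  then have AC: "0 < A + C" using assms by simp
  have "(A + C) * (A * X\<^sup>2 - 2 * B * X * Y + C * Y\<^sup>2) - (A * C - B\<^sup>2) * (X\<^sup>2 + Y\<^sup>2)
      = (A * X - B * Y)\<^sup>2 + (B * X - C * Y)\<^sup>2"
    by (simp add: algebra_simps power2_eq_square)
  then have "(A * C - B\<^sup>2) * (X\<^sup>2 + Y\<^sup>2) \<le> (A * X\<^sup>2 - 2 * B * X * Y + C * Y\<^sup>2) * (A + C)"
    using sum_power2_ge_zero[of "A * X - B * Y" "B * X - C * Y"]
    unfolding mult.commute[of _ "A + C"] by linarith
  then show ?thesis using AC by (simp add: pos_divide_le_eq)
qed

section \<open>Hopf's boundary point lemma and the strong maximum principle\<close>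

lemma dist_prod_sq:
  fixes p q :: "real \<times> real"
  shows "(dist p q)\<^sup>2 = (fst p - fst q)\<^sup>2 + (snd p - snd q)\<^sup>2"
  by (simp add: dist_prod_def dist_real_def)

text \<open>\<open>D\<close> may contain frontier points: derivatives are two-sided everywhere,
  which half discs allow because representatives extend smoothly across the edge. Symmetry of the
  second derivatives is built in, and the sign at \<open>B\<close> matches the minimal surface
  equation.\<close>

locale elliptic_solution =
  fixes D :: "(real \<times> real) set"
    and u ux uy uxx uxy uyy A B C a b :: "real \<times> real \<Rightarrow> real"
  assumes du: "\<And>p. p \<in> D \<Longrightarrow> (u has_derivative (\<lambda>h. ux p * fst h + uy p * snd h)) (at p)"
    and dux: "\<And>p. p \<in> D \<Longrightarrow> (ux has_derivative (\<lambda>h. uxx p * fst h + uxy p * snd h)) (at p)"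
    and duy: "\<And>p. p \<in> D \<Longrightarrow> (uy has_derivative (\<lambda>h. uxy p * fst h + uyy p * snd h)) (at p)"
    and cont: "continuous_on D A" "continuous_on D B" "continuous_on D C"
      "continuous_on D a" "continuous_on D b"
    and ell: "\<And>p. p \<in> D \<Longrightarrow> 0 < A p" "\<And>p. p \<in> D \<Longrightarrow> (B p)\<^sup>2 < A p * C p"
    and pde: "\<And>p. p \<in> D \<Longrightarrow> A p * uxx p - 2 * B p * uxy p + C p * uyy p = a p * ux p + b p * uy p"
begin

lemma u_cont: "continuous_on D u"
  by (meson du continuous_at_imp_continuous_on has_derivative_continuous)

text \<open>The two constants behind Hopf's barrier: \<open>l\<close> is an ellipticity constant on
  \<open>K\<close>, and \<open>k\<close> dominates the terms that work against the barrier. The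
  factor \<open>R\<close> accounts for the coordinates relative to the centre, which multiply
  \<open>a\<close> and \<open>b\<close> there.\<close>

lemma uniform_bounds:
  assumes K: "compact K" "K \<subseteq> D" "K \<noteq> {}" and R: "0 < R"
  obtains l k where "0 < l" "0 \<le> k"
    "\<And>p. p \<in> K \<Longrightarrow> l \<le> (A p * C p - (B p)\<^sup>2) / (A p + C p)"
    "\<And>p. p \<in> K \<Longrightarrow> A p + C p + R * \<bar>a p\<bar> + R * \<bar>b p\<bar> \<le> k"
proof -
  note c = cont[THEN continuous_on_subset, OF K(2)]
  have pos: "0 < A p + C p" if "p \<in> K" for p
  proof -
    have "0 < A p * C p" using ell(2)[of p] that K(2) zero_le_power2[of "B p"]
      by (meson le_less_trans subsetD)
    then show ?thesis using ell(1)[of p] that K(2) by (auto simp: zero_less_mult_iff)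
  qed
  have "continuous_on K (\<lambda>p. (A p * C p - (B p)\<^sup>2) / (A p + C p))"
    by (intro continuous_intros c) (use pos in force)
  then obtain p0 where p0: "p0 \<in> K"
      "\<And>p. p \<in> K \<Longrightarrow> (A p0 * C p0 - (B p0)\<^sup>2) / (A p0 + C p0) \<le> (A p * C p - (B p)\<^sup>2) / (A p + C p)"
    using continuous_attains_inf[OF K(1,3)] by blast
  have "continuous_on K (\<lambda>p. A p + C p + R * \<bar>a p\<bar> + R * \<bar>b p\<bar>)"
    by (intro continuous_intros c)
  then obtain p1 where p1: "p1 \<in> K"
      "\<And>p. p \<in> K \<Longrightarrow> A p + C p + R * \<bar>a p\<bar> + R * \<bar>b p\<bar> \<le> A p1 + C p1 + R * \<bar>a p1\<bar> + R * \<bar>b p1\<bar>"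
    using continuous_attains_sup[OF K(1,3)] by blast
  show ?thesis
  proof (rule that[OF _ _ p0(2) p1(2)])
    show "0 < (A p0 * C p0 - (B p0)\<^sup>2) / (A p0 + C p0)"
      using ell(2)[of p0] pos[of p0] p0 K(2) by auto
    show "0 \<le> A p1 + C p1 + R * \<bar>a p1\<bar> + R * \<bar>b p1\<bar>"
      using pos[OF p1(1)] R by (intro add_nonneg_nonneg[of "A p1 + C p1" "R * \<bar>a p1\<bar>", THEN add_nonneg_nonneg]) auto
  qed
qed

text \<open>Barrier argument: a small multiple of
  \<open>exp (- \<alpha> * (dist y p)\<^sup>2)\<close>, normalised to vanish on the outer circle, is
  added to \<open>u\<close> without raising the maximum over an annulus above \<open>M\<close>. As
  the barrier grows strictly from \<open>q\<close> towards the centre, \<open>u\<close> has to fall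
  strictly.\<close>

lemma Hopf_lemma:
  assumes R: "0 < R" and cb: "cball y R \<subseteq> D" and q: "dist y q = R"
    and less: "\<And>p. p \<in> ball y R \<Longrightarrow> u p < M" and le: "\<And>p. p \<in> cball y R \<Longrightarrow> u p \<le> M"
    and uq: "u q = M"
  shows "ux q * fst (y - q) + uy q * snd (y - q) < 0"
proof -
  have "cball y R \<noteq> {}" using R by auto
  then obtain l k where l: "0 < l" and k: "0 \<le> k"
    and lb: "\<And>p. p \<in> cball y R \<Longrightarrow> l \<le> (A p * C p - (B p)\<^sup>2) / (A p + C p)"
    and kb: "\<And>p. p \<in> cball y R \<Longrightarrow> A p + C p + R * \<bar>a p\<bar> + R * \<bar>b p\<bar> \<le> k"
    using uniform_bounds[OF compact_cball cb _ R] by blast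
  \<comment> \<open>At distance at least \<open>R/2\<close> from \<open>y\<close>, the term
    \<open>4 * \<alpha> * Q\<close> below is at least \<open>\<alpha> * (l * R\<^sup>2)\<close>;
    this choice makes it exceed \<open>2 * k\<close>.\<close>
  define \<alpha> where "\<alpha> = (2 * k + 1) / (l * R\<^sup>2)"
  have lR: "0 < l * R\<^sup>2" using l R by simp
  have \<alpha>: "0 < \<alpha>" using lR k by (simp add: \<alpha>_def)
  have \<alpha>k: "2 * k < \<alpha> * (l * R\<^sup>2)" using l R by (simp add: \<alpha>_def)
  define X where "X p = fst p - fst y" for p :: "real \<times> real"
  define Y where "Y p = snd p - snd y" for p :: "real \<times> real"
  define h where "h p = exp (- \<alpha> * ((X p)\<^sup>2 + (Y p)\<^sup>2))" for p
  have hpos: "0 < h p" for p by (simp add: h_def)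
  have XY: "(X p)\<^sup>2 + (Y p)\<^sup>2 = (dist y p)\<^sup>2" for p
    by (simp add: dist_prod_sq X_def Y_def power2_commute)
  have dX: "(X has_derivative fst) (at p)" and dY: "(Y has_derivative snd) (at p)" for p
    unfolding X_def Y_def by (auto intro!: derivative_eq_intros)
  have dh: "(h has_derivative (\<lambda>v. - 2 * \<alpha> * X p * h p * fst v + - 2 * \<alpha> * Y p * h p * snd v)) (at p)" for p
    unfolding h_def
    by (rule derivative_eq_intros dX dY refl)+ (simp add: algebra_simps)
  define S where "S = sphere y (R/2)"
  have S: "compact S" "S \<noteq> {}" "S \<subseteq> ball y R" using R by (auto simp: S_def)
  have "continuous_on S u" using continuous_on_subset[OF u_cont] S(3) cb by (meson ball_subset_cball subset_trans)
  then obtain s where s: "s \<in> S" "\<And>p. p \<in> S \<Longrightarrow> u p \<le> u s"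
    using continuous_attains_sup[OF S(1,2)] by blast
  \<comment> \<open>On the inner circle \<open>u\<close> is at most \<open>M - \<epsilon>\<close>
    and \<open>h - k0\<close> is at most 1, so \<open>w\<close> does not exceed \<open>M\<close>
    there.\<close>
  define \<epsilon> where "\<epsilon> = M - u s"
  have \<epsilon>: "0 < \<epsilon>" using less[OF subsetD[OF S(3) s(1)]] by (simp add: \<epsilon>_def)
  define k0 where "k0 = exp (- \<alpha> * R\<^sup>2)"
  define w where "w p = u p + \<epsilon> * (h p - k0)" for p
  define wx where "wx p = ux p + \<epsilon> * (- 2 * \<alpha> * X p * h p)" for p
  define wy where "wy p = uy p + \<epsilon> * (- 2 * \<alpha> * Y p * h p)" for p
  define wxx where "wxx p = uxx p + \<epsilon> * ((4 * \<alpha>\<^sup>2 * (X p)\<^sup>2 - 2 * \<alpha>) * h p)" for p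
  define wxy where "wxy p = uxy p + \<epsilon> * (4 * \<alpha>\<^sup>2 * X p * Y p * h p)" for p
  define wyy where "wyy p = uyy p + \<epsilon> * ((4 * \<alpha>\<^sup>2 * (Y p)\<^sup>2 - 2 * \<alpha>) * h p)" for p
  have dw: "(w has_derivative (\<lambda>v. wx p * fst v + wy p * snd v)) (at p)" if "p \<in> D" for p
    unfolding w_def wx_def wy_def
    by (rule derivative_eq_intros du dh that refl)+ (simp add: algebra_simps)
  have dwx: "(wx has_derivative (\<lambda>v. wxx p * fst v + wxy p * snd v)) (at p)" if "p \<in> D" for p
    unfolding wx_def wxx_def wxy_def
    by (rule derivative_eq_intros dux dX dh that refl)+ (simp add: algebra_simps power2_eq_square)
  have dwy: "(wy has_derivative (\<lambda>v. wxy p * fst v + wyy p * snd v)) (at p)" if "p \<in> D" for p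
    unfolding wy_def wyy_def wxy_def
    by (rule derivative_eq_intros duy dY dh that refl)+ (simp add: algebra_simps power2_eq_square)
  define Ann where "Ann = cball y R - ball y (R/2)"
  have Ann: "compact Ann" "q \<in> Ann" using q R by (auto simp: Ann_def intro: compact_diff)
  have AnnD: "Ann \<subseteq> D" using cb by (auto simp: Ann_def)
  have "continuous_on Ann w"
    by (meson AnnD dw continuous_at_imp_continuous_on has_derivative_continuous subsetD)
  then obtain p where p: "p \<in> Ann" "\<And>r. r \<in> Ann \<Longrightarrow> w r \<le> w p"
    using continuous_attains_sup[OF Ann(1)] Ann(2) by blast
  have "w p \<le> M"
  proof (rule ccontr)
    assume gt: "\<not> w p \<le> M"
    have "dist y p \<noteq> R"
    proof
      assume "dist y p = R"
      then have "h p = k0" using XY[of p] by (simp add: h_def k0_def)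
      then show False using gt le[of p] \<open>dist y p = R\<close> by (simp add: w_def)
    qed
    moreover have "dist y p \<noteq> R / 2"
    proof
      assume "dist y p = R / 2"
      then have "u p \<le> u s" using s by (simp add: S_def)
      moreover have "h p - k0 \<le> 1"
      proof -
        have "h p \<le> 1" using \<alpha> by (simp add: h_def mult_nonneg_nonneg)
        moreover have "0 < k0" by (simp add: k0_def)
        ultimately show ?thesis by linarith
      qed
      then have "\<epsilon> * (h p - k0) \<le> \<epsilon>" using \<epsilon> mult_left_mono[of "h p - k0" 1 \<epsilon>] by simp
      ultimately show False using gt by (simp add: w_def \<epsilon>_def)
    qed
    ultimately have pin: "p \<in> ball y R - cball y (R/2)" using p(1) by (auto simp: Ann_def)
    let ?N = "ball y R - cball y (R/2)"
    have NA: "?N \<subseteq> Ann" by (auto simp: Ann_def)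
    have pD: "p \<in> D" using AnnD p(1) by auto
    have max: "wx p = 0" "wy p = 0" "A p * wxx p - 2 * B p * wxy p + C p * wyy p \<le> 0"
      using elliptic_operator_nonpos_at_max[of ?N p w wx wy "wxx p" "wxy p" "wyy p" "A p" "B p" "C p"]
        pin dw dwx[OF pD] dwy[OF pD] p(2) NA AnnD ell[OF pD] by (auto simp: subset_iff open_Diff)
    define Q where "Q = A p * (X p)\<^sup>2 - 2 * B p * X p * Y p + C p * (Y p)\<^sup>2"
    \<comment> \<open>The share of \<open>u\<close> cancels by the equation and that of the barrier
      is positive, whereas at an interior maximum of \<open>w\<close> the left-hand side is
      nonpositive.\<close>
    have "A p * wxx p - 2 * B p * wxy p + C p * wyy p - (a p * wx p + b p * wy p)
      = (A p * uxx p - 2 * B p * uxy p + C p * uyy p - (a p * ux p + b p * uy p))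
        + \<epsilon> * h p * \<alpha> * (4 * \<alpha> * Q - 2 * (A p + C p) + 2 * (a p * X p + b p * Y p))"
      unfolding wx_def wy_def wxx_def wxy_def wyy_def Q_def by algebra
    also have "\<dots> = \<epsilon> * h p * \<alpha> * (4 * \<alpha> * Q - 2 * (A p + C p) + 2 * (a p * X p + b p * Y p))"
      using pde[OF pD] by simp
    also have "\<dots> > 0"
    proof -
      have pc: "p \<in> cball y R" using pin by auto
      have d: "R / 2 < dist y p" "dist y p < R" using pin by auto
      have "(R/2)\<^sup>2 \<le> (dist y p)\<^sup>2" using d R by (intro power_mono) auto
      then have "l * (R/2)\<^sup>2 \<le> l * ((X p)\<^sup>2 + (Y p)\<^sup>2)" using l XY[of p] by simp
      also have "\<dots> \<le> Q"
        using elliptic_form_lower_bound[OF ell[OF pD], of "X p" "Y p"]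
          mult_right_mono[OF lb[OF pc], of "(X p)\<^sup>2 + (Y p)\<^sup>2"] unfolding Q_def
        by (meson order_trans sum_power2_ge_zero)
      finally have "\<alpha> * (l * (R/2)\<^sup>2) \<le> \<alpha> * Q" using \<alpha> by simp
      then have "\<alpha> * (l * R\<^sup>2) \<le> 4 * (\<alpha> * Q)" by (simp add: power_divide)
      then have 1: "2 * k < 4 * \<alpha> * Q" using \<alpha>k by linarith
      have "(X p)\<^sup>2 \<le> R\<^sup>2" "(Y p)\<^sup>2 \<le> R\<^sup>2"
        using XY[of p] power_mono[of "dist y p" R 2] d zero_le_power2[of "X p"] zero_le_power2[of "Y p"]
        by (simp_all, linarith+)
      then have "\<bar>X p\<bar> \<le> R" "\<bar>Y p\<bar> \<le> R" using R by (auto simp: power2_le_iff_abs_le)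
      then have "\<bar>a p * X p\<bar> \<le> R * \<bar>a p\<bar>" "\<bar>b p * Y p\<bar> \<le> R * \<bar>b p\<bar>"
        by (auto simp: abs_mult mult.commute[of R] mult_left_mono)
      then have "- (R * \<bar>a p\<bar>) \<le> a p * X p" "- (R * \<bar>b p\<bar>) \<le> b p * Y p"
        unfolding abs_le_iff by linarith+
      then have "0 < 4 * \<alpha> * Q - 2 * (A p + C p) + 2 * (a p * X p + b p * Y p)"
        using 1 kb[OF pc] by argo
      then show ?thesis using \<epsilon> hpos[of p] \<alpha> by simp
    qed
    finally show False using max by simp
  qed
  then have wle: "w r \<le> M" if "r \<in> Ann" for r using p(2) that by (meson order_trans)
  have hq: "h q = k0" using XY[of q] q by (simp add: h_def k0_def)
  have qD: "q \<in> D" using AnnD Ann(2) by auto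
  have line: "((\<lambda>t. w (q + t *\<^sub>R (y - q))) has_real_derivative (wx q * fst (y - q) + wy q * snd (y - q))) (at 0)"
    by (rule has_real_derivative_along_line) (use dw[OF qD] in simp)
  have "wx q * fst (y - q) + wy q * snd (y - q) \<le> 0"
  proof (rule nonpos_derivative_of_local_max_right[OF line, of "1/2"])
    fix t :: real assume t: "0 < t" "t < 1/2"
    have "y - (q + t *\<^sub>R (y - q)) = (1 - t) *\<^sub>R (y - q)" by (simp add: algebra_simps)
    then have "dist y (q + t *\<^sub>R (y - q)) = (1 - t) * R" using q t by (simp add: dist_norm)
    moreover have "R / 2 \<le> (1 - t) * R" "(1 - t) * R \<le> R"
      using R t mult_right_mono[of "1/2" "1 - t" R] mult_right_mono[of "1 - t" 1 R] by auto
    ultimately have "q + t *\<^sub>R (y - q) \<in> Ann" by (simp add: Ann_def)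
    then show "w (q + t *\<^sub>R (y - q)) \<le> w (q + 0 *\<^sub>R (y - q))"
      using wle uq hq by (simp add: w_def)
  qed simp
  \<comment> \<open>The last summand is the growth of the barrier towards the centre; it turns the
    weak inequality for \<open>w\<close> into a strict one for \<open>u\<close>.\<close>
  moreover have "wx q * fst (y - q) + wy q * snd (y - q)
      = ux q * fst (y - q) + uy q * snd (y - q) + \<epsilon> * 2 * \<alpha> * h q * ((X q)\<^sup>2 + (Y q)\<^sup>2)"
    by (simp add: wx_def wy_def X_def Y_def algebra_simps power2_eq_square)
  moreover have "0 < \<epsilon> * 2 * \<alpha> * h q * ((X q)\<^sup>2 + (Y q)\<^sup>2)"
    using XY[of q] q R \<epsilon> \<alpha> hpos[of q] by simp
  ultimately show ?thesis by linarith
qed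

lemma strong_maximum_principle:
  assumes H: "open H" "connected H" "H \<subseteq> D" and le: "\<And>p. p \<in> H \<Longrightarrow> u p \<le> M"
    and p0: "p0 \<in> H" "u p0 = M" and p: "p \<in> H"
  shows "u p = M"
proof -
  let ?Z = "{p \<in> H. u p = M}"
  have uH: "continuous_on H u" using continuous_on_subset[OF u_cont H(3)] .
  have "openin (top_of_set H) ?Z"
  proof (subst openin_contains_ball, intro conjI ballI)
    fix x assume x: "x \<in> ?Z"
    obtain r where r: "0 < r" "ball x r \<subseteq> H" using x H(1) openE by blast
    \<comment> \<open>Since \<open>x\<close> is itself a contact point, the contact point nearest to
      \<open>y\<close> is less than \<open>r/3\<close> away from \<open>y\<close>; the touching disc
      then stays within \<open>2 * r / 3\<close> of \<open>x\<close>, hence in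
      \<open>H\<close>.\<close>
    have "u y = M" if y: "y \<in> ball x (r/3)" for y
    proof (rule ccontr)
      assume "u y \<noteq> M"
      \<comment> \<open>The largest ball around y avoiding the contact set touches it at an interior
        maximum, where the gradient vanishes; this contradicts the boundary point lemma.\<close>
      define Z' where "Z' = {p \<in> cball x (2 * r / 3). u p = M}"
      have cbH: "cball x (2 * r / 3) \<subseteq> H"
      proof
        fix z assume "z \<in> cball x (2 * r / 3)"
        then have "z \<in> ball x r" using r(1) by (simp add: field_simps)
        then show "z \<in> H" using r(2) by blast
      qed
      have "closed Z'" unfolding Z'_def
        using continuous_closed_preimage_constant[OF continuous_on_subset[OF uH cbH] closed_cball, of M] by simp
      moreover have xZ: "x \<in> Z'" using x r by (auto simp: Z'_def)
      ultimately obtain q where q: "q \<in> Z'" "\<And>z. z \<in> Z' \<Longrightarrow> dist y q \<le> dist y z"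
        using distance_attains_inf[of Z' y] by blast
      define R where "R = dist y q"
      have "R \<le> dist y x" using q(2)[OF xZ] by (simp add: R_def)
      then have Rr: "R < r / 3" using y by (simp add: dist_commute)
      have "q \<noteq> y" using q(1) \<open>u y \<noteq> M\<close> by (auto simp: Z'_def)
      then have R: "0 < R" by (simp add: R_def)
      have sub: "cball y R \<subseteq> cball x (2 * r / 3)"
      proof
        fix z assume "z \<in> cball y R"
        then have "dist y z \<le> R" by simp
        moreover have "dist x y < r / 3" using y by simp
        ultimately have "dist x z \<le> 2 * r / 3" using dist_triangle[of x z y] Rr by linarith
        then show "z \<in> cball x (2 * r / 3)" by simp
      qed
      have qH: "q \<in> H" "u q = M" using q(1) cbH by (auto simp: Z'_def)
      have "ux q * fst (y - q) + uy q * snd (y - q) < 0"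
      proof (rule Hopf_lemma[OF R])
        show "cball y R \<subseteq> D" using sub cbH H(3) by blast
        show "u z < M" if "z \<in> ball y R" for z
        proof -
          have "z \<notin> Z'" using q(2)[of z] that by (auto simp: R_def)
          moreover have "z \<in> cball x (2 * r / 3)" using sub that ball_subset_cball by blast
          ultimately show ?thesis using le[of z] cbH by (force simp: Z'_def)
        qed
        show "u z \<le> M" if "z \<in> cball y R" for z using le sub cbH that by blast
      qed (use R_def qH in auto)
      moreover have "ux q = 0 \<and> uy q = 0"
      proof -
        have qD: "q \<in> D" using qH H by auto
        show ?thesis
          using elliptic_operator_nonpos_at_max(1,2)[of H q u ux uy "uxx q" "uxy q" "uyy q" "A q" "B q" "C q"]
            H qH du dux[OF qD] duy[OF qD] le ell[OF qD] by auto
      qed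
      ultimately show False by simp
    qed
    then show "\<exists>e>0. ball x e \<inter> H \<subseteq> ?Z"
      by (intro exI[of _ "r/3"]) (use r in auto)
  qed auto
  moreover have "closedin (top_of_set H) ?Z"
    using continuous_closedin_preimage_constant[OF uH] by simp
  ultimately have "?Z = H"
    using H(2) p0 unfolding connected_clopen by blast
  then show ?thesis using p by auto
qed

end

section \<open>Symmetry of the mixed second derivatives\<close>

text \<open>The mean value theorem in the first variable reduces the second difference to a
  difference of two values of \<open>ux\<close>; linearising \<open>ux\<close> at \<open>p\<close>
  cancels the \<open>a\<close> terms. Each of the two values errs by \<open>e/4\<close> times a norm
  of at most \<open>2 * t\<close>.\<close>

lemma mixed_difference_estimate:
  fixes u ux uy :: "real \<times> real \<Rightarrow> real"
  assumes W: "open W" "p \<in> W"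
    and du: "\<And>q. q \<in> W \<Longrightarrow> (u has_derivative (\<lambda>h. ux q * fst h + uy q * snd h)) (at q)"
    and dux: "(ux has_derivative (\<lambda>h. a * fst h + b * snd h)) (at p)"
    and e: "0 < e"
  shows "\<exists>d>0. \<forall>t. 0 < t \<and> t < d \<longrightarrow>
    \<bar>u (p + (t, t)) - u (p + (t, 0)) - u (p + (0, t)) + u p - b * t\<^sup>2\<bar> \<le> e * t\<^sup>2"
proof -
  obtain r where r: "0 < r" "ball p r \<subseteq> W" using W openE by blast
  have "\<exists>d>0. \<forall>q. norm (q - p) < d \<longrightarrow>
      norm (ux q - ux p - (a * fst (q - p) + b * snd (q - p))) \<le> (e/4) * norm (q - p)"
    using dux[unfolded has_derivative_at_alt, THEN conjunct2, rule_format, of "e/4"] e by simp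
  then obtain d where d: "0 < d" "\<And>q. norm (q - p) < d \<Longrightarrow>
      \<bar>ux q - ux p - (a * fst (q - p) + b * snd (q - p))\<bar> \<le> (e/4) * norm (q - p)" by auto
  have main: "\<bar>u (p + (t, t)) - u (p + (t, 0)) - u (p + (0, t)) + u p - b * t\<^sup>2\<bar> \<le> e * t\<^sup>2"
    if t: "0 < t" "2 * t < min r d" for t
  proof -
    have near: "norm (\<sigma>, \<tau>) \<le> 2 * t" if "0 \<le> \<sigma>" "\<sigma> \<le> t" "0 \<le> \<tau>" "\<tau> \<le> t" for \<sigma> \<tau> :: real
      using norm_Pair_le[of \<sigma> \<tau>] that by simp
    have inW: "p + (\<sigma>, \<tau>) \<in> W" if "0 \<le> \<sigma>" "\<sigma> \<le> t" "0 \<le> \<tau>" "\<tau> \<le> t" for \<sigma> \<tau> :: real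
    proof -
      have "p + (\<sigma>, \<tau>) \<in> ball p r" using near[OF that] t
        by (simp add: dist_norm norm_minus_cancel[of "(\<sigma>, \<tau>)", simplified])
      then show ?thesis using r(2) by blast
    qed
    define g where "g \<sigma> = u (p + (\<sigma>, t)) - u (p + (\<sigma>, 0))" for \<sigma>
    have dline: "((\<lambda>\<sigma>. u (p + (\<sigma>, \<tau>))) has_real_derivative ux (p + (\<sigma>, \<tau>))) (at \<sigma>)"
      if "0 \<le> \<sigma>" "\<sigma> \<le> t" "0 \<le> \<tau>" "\<tau> \<le> t" for \<sigma> \<tau>
    proof -
      have eq: "p + (0, \<tau>) + s *\<^sub>R (1, 0) = p + (s, \<tau>)" for s by (simp add: prod_eq_iff)
      show ?thesis
        using has_real_derivative_along_line[of u "ux (p + (\<sigma>, \<tau>))" "uy (p + (\<sigma>, \<tau>))" "p + (0, \<tau>)" \<sigma> "(1, 0)"]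
          du[OF inW[OF that]] unfolding eq by simp
    qed
    have "\<exists>z. 0 < z \<and> z < t \<and> g t - g 0 = (t - 0) * (ux (p + (z, t)) - ux (p + (z, 0)))"
      by (rule MVT2[OF t(1)]) (auto simp: g_def intro!: DERIV_diff dline t less_imp_le)
    then obtain z where z: "0 < z" "z < t" "g t - g 0 = t * (ux (p + (z, t)) - ux (p + (z, 0)))" by auto
    have e': "e/4 * norm (\<sigma>, \<tau>) \<le> e/4 * (2 * t)" if "0 \<le> \<sigma>" "\<sigma> \<le> t" "0 \<le> \<tau>" "\<tau> \<le> t" for \<sigma> \<tau> :: real
      using near[OF that] e by (intro mult_left_mono) auto
    have e1: "\<bar>ux (p + (z, t)) - ux p - (a * z + b * t)\<bar> \<le> e/4 * (2 * t)"
      by (rule order_trans[OF _ e'[of z t]]) (use d(2)[of "p + (z, t)"] near[of z t] z t in auto)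
    have e2: "\<bar>ux (p + (z, 0)) - ux p - a * z\<bar> \<le> e/4 * (2 * t)"
      by (rule order_trans[OF _ e'[of z 0]]) (use d(2)[of "p + (z, 0)"] near[of z 0] z t in auto)
    have "\<bar>ux (p + (z, t)) - ux (p + (z, 0)) - b * t\<bar> \<le> e * t"
      using e1 e2 unfolding abs_le_iff by (simp add: field_simps; linarith)
    then have "t * \<bar>ux (p + (z, t)) - ux (p + (z, 0)) - b * t\<bar> \<le> t * (e * t)"
      using t by simp
    moreover have "u (p + (t, t)) - u (p + (t, 0)) - u (p + (0, t)) + u p - b * t\<^sup>2
        = t * (ux (p + (z, t)) - ux (p + (z, 0)) - b * t)"
      using z(3) by (simp add: g_def algebra_simps power2_eq_square flip: zero_prod_def)
    ultimately show ?thesis using t by (simp add: abs_mult power2_eq_square mult.commute mult.left_commute)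
  qed
  show ?thesis
    by (rule exI[of _ "min r d / 2"]) (use main r d in auto)
qed

text \<open>The second difference over a square is symmetric in the coordinates, so the estimate for
  \<open>u\<close> and the one for \<open>u\<close> with swapped arguments recover both mixed
  derivatives from the same quantity. With \<open>e\<close> a quarter of the gap, the two errors add
  up to only half of it.\<close>

lemma mixed_partials_commute:
  fixes u ux uy :: "real \<times> real \<Rightarrow> real"
  assumes W: "open W" "p \<in> W"
    and du: "\<And>q. q \<in> W \<Longrightarrow> (u has_derivative (\<lambda>h. ux q * fst h + uy q * snd h)) (at q)"
    and dux: "(ux has_derivative (\<lambda>h. a * fst h + b * snd h)) (at p)"
    and duy: "(uy has_derivative (\<lambda>h. b' * fst h + c * snd h)) (at p)"
  shows "b' = b"
proof (rule ccontr)
  assume ne: "b' \<noteq> b"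
  define e where "e = \<bar>b' - b\<bar> / 4"
  have e: "0 < e" using ne by (simp add: e_def)
  have sw: "(prod.swap has_derivative prod.swap) (at q)" for q :: "real \<times> real"
    unfolding prod.swap_def by (auto intro!: derivative_eq_intros)
  have W': "open (prod.swap -` W)" "prod.swap p \<in> prod.swap -` W"
    using W by (auto intro!: open_vimage continuous_on_swap)
  obtain d where d: "0 < d" "\<And>t. 0 < t \<Longrightarrow> t < d \<Longrightarrow>
      \<bar>u (p + (t, t)) - u (p + (t, 0)) - u (p + (0, t)) + u p - b * t\<^sup>2\<bar> \<le> e * t\<^sup>2"
    using mixed_difference_estimate[OF W du dux e] by auto
  have 1: "((u \<circ> prod.swap) has_derivative (\<lambda>h. (uy \<circ> prod.swap) q * fst h + (ux \<circ> prod.swap) q * snd h)) (at q)"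
    if "q \<in> prod.swap -` W" for q
    using diff_chain_at[OF sw du, of q] that by (simp add: o_def add.commute)
  have 2: "((uy \<circ> prod.swap) has_derivative (\<lambda>h. c * fst h + b' * snd h)) (at (prod.swap p))"
    using diff_chain_at[OF sw, of uy "\<lambda>h. b' * fst h + c * snd h" "prod.swap p"] duy
    by (simp add: o_def add.commute)
  obtain d' where d': "0 < d'" "\<And>t. 0 < t \<Longrightarrow> t < d' \<Longrightarrow>
      \<bar>(u \<circ> prod.swap) (prod.swap p + (t, t)) - (u \<circ> prod.swap) (prod.swap p + (t, 0))
        - (u \<circ> prod.swap) (prod.swap p + (0, t)) + (u \<circ> prod.swap) (prod.swap p) - b' * t\<^sup>2\<bar> \<le> e * t\<^sup>2"
    using mixed_difference_estimate[OF W' 1 2 e] by auto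
  define t where "t = min d d' / 2"
  have t: "0 < t" "t < d" "t < d'" using d(1) d'(1) by (auto simp: t_def)
  have swp: "prod.swap (prod.swap p + (x, y)) = p + (y, x)" for x y by (simp add: prod_eq_iff)
  have "\<bar>b' * t\<^sup>2 - b * t\<^sup>2\<bar> \<le> 2 * (e * t\<^sup>2)"
    using d(2)[OF t(1,2)] d'(2)[OF t(1,3)] by (simp add: swp)
  then have "\<bar>b' - b\<bar> * t\<^sup>2 \<le> (2 * e) * t\<^sup>2"
    by (simp add: abs_mult left_diff_distrib[symmetric] mult.assoc)
  then have "\<bar>b' - b\<bar> \<le> 2 * e" using t by (simp add: mult_le_cancel_right)
  then show False using ne by (simp add: e_def)
qed

section \<open>Minimal immersions of half discs\<close>

lemma smooth_onD:
  assumes "smooth_on W F"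
  shows smooth_on_continuous: "continuous_on W F"
    and smooth_on_differentiable: "x \<in> W \<Longrightarrow> F differentiable (at x)"
    and smooth_on_frechet: "smooth_on W (\<lambda>x. frechet_derivative F (at x) v)"
proof -
  have k: "Ck_on (Suc k) W F" for k using assms by (simp add: smooth_on_def del: Ck_on.simps)
  show "continuous_on W F" using k[of 0] by simp
  show "F differentiable (at x)" if "x \<in> W" using k[of 0] that by simp
  show "smooth_on W (\<lambda>x. frechet_derivative F (at x) v)"
    unfolding smooth_on_def using k by simp
qed

lemma smooth_on_partials:
  assumes "smooth_on W F"
  shows "smooth_on W (pu F)" "smooth_on W (pv F)"
  using smooth_on_frechet[OF assms] unfolding pu_def[abs_def] pv_def[abs_def] by auto

lemma frechet_derivative_partials:
  fixes F :: "real \<times> real \<Rightarrow> 'b::real_normed_vector"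
  assumes "F differentiable (at p)"
  shows "frechet_derivative F (at p) h = fst h *\<^sub>R pu F p + snd h *\<^sub>R pv F p"
proof -
  have lin: "linear (frechet_derivative F (at p))" by (rule linear_frechet_derivative[OF assms])
  have "h = fst h *\<^sub>R (1, 0) + snd h *\<^sub>R (0, 1)" by (simp add: prod_eq_iff)
  then have "frechet_derivative F (at p) h
      = frechet_derivative F (at p) (fst h *\<^sub>R (1, 0) + snd h *\<^sub>R (0, 1))" by simp
  also have "\<dots> = fst h *\<^sub>R pu F p + snd h *\<^sub>R pv F p"
    unfolding pu_def pv_def linear_add[OF lin] linear_scale[OF lin] ..
  finally show ?thesis .
qed

lemma smooth_has_derivative:
  fixes F :: "real \<times> real \<Rightarrow> 'b::real_normed_vector"
  assumes "smooth_on W F" "p \<in> W"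
  shows "(F has_derivative (\<lambda>h. fst h *\<^sub>R pu F p + snd h *\<^sub>R pv F p)) (at p)"
proof -
  have d: "F differentiable (at p)" by (rule smooth_on_differentiable[OF assms])
  then have "(F has_derivative frechet_derivative F (at p)) (at p)"
    by (simp add: frechet_derivative_works)
  then show ?thesis by (rule has_derivative_eq_rhs) (simp add: fun_eq_iff frechet_derivative_partials[OF d])
qed

lemma smooth_has_derivative_inner:
  fixes F :: "real \<times> real \<Rightarrow> 'b::real_inner"
  assumes "smooth_on W F" "p \<in> W"
  shows "((\<lambda>p. k \<bullet> F p) has_derivative (\<lambda>h. (k \<bullet> pu F p) * fst h + (k \<bullet> pv F p) * snd h)) (at p)"
  by (rule has_derivative_eq_rhs[OF has_derivative_inner_right[OF smooth_has_derivative[OF assms]]])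
     (simp add: fun_eq_iff inner_add_right mult.commute)

text \<open>By Lagrange's identity a vanishing cross product is a linear relation between the
  partial derivatives, in which \<open>pv F p\<close> has the coefficient
  \<open>- (pu F p \<bullet> pu F p)\<close>. Injectivity forces this coefficient to be 0, and then
  excludes \<open>pu F p = 0\<close>.\<close>

lemma immersion_cross_nonzero:
  fixes F :: "real \<times> real \<Rightarrow> real^3"
  assumes d: "F differentiable (at p)" and inj: "inj (frechet_derivative F (at p))"
  shows "cross3 (pu F p) (pv F p) \<noteq> 0"
proof
  assume "cross3 (pu F p) (pv F p) = 0"
  then have "(pu F p \<bullet> pv F p) *\<^sub>R pu F p - (pu F p \<bullet> pu F p) *\<^sub>R pv F p = 0"
    using Lagrange[of "pu F p" "pu F p" "pv F p"] by simp
  then have "frechet_derivative F (at p) (pu F p \<bullet> pv F p, - (pu F p \<bullet> pu F p)) = frechet_derivative F (at p) 0"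
    by (simp add: frechet_derivative_partials[OF d])
  then have "pu F p = 0" using inj by (auto dest!: injD simp: zero_prod_def)
  then have "frechet_derivative F (at p) (1, 0) = frechet_derivative F (at p) 0"
    by (simp add: frechet_derivative_partials[OF d])
  then show False using inj by (auto dest!: injD simp: zero_prod_def)
qed

lemma cross_norm_sq:
  fixes x y :: "real^3"
  shows "(norm (cross3 x y))\<^sup>2 = (x \<bullet> x) * (y \<bullet> y) - (x \<bullet> y)\<^sup>2"
  using norm_cross_dot[of x y] by (simp add: power_mult_distrib power2_norm_eq_inner)

section \<open>The elliptic equation behind minimality\<close>

text \<open>Cramer's rule for the Gram matrix of \<open>x\<close> and \<open>y\<close>, read off
  from a double cross product with the normal, which reproduces a tangential \<open>V\<close> up to
  the factor \<open>\<Delta>\<close>. The explicit coefficients make continuity in the base point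
  visible.\<close>

lemma tangent_decomposition:
  fixes x y V :: "real^3"
  defines "\<Delta> \<equiv> (x \<bullet> x) * (y \<bullet> y) - (x \<bullet> y)\<^sup>2"
  assumes perp: "cross3 x y \<bullet> V = 0" and nz: "\<Delta> \<noteq> 0"
  shows "V = (((V \<bullet> x) * (y \<bullet> y) - (V \<bullet> y) * (x \<bullet> y)) / \<Delta>) *\<^sub>R x
           + (((V \<bullet> y) * (x \<bullet> x) - (V \<bullet> x) * (x \<bullet> y)) / \<Delta>) *\<^sub>R y"
proof -
  let ?n = "cross3 x y"
  have "\<Delta> *\<^sub>R V = cross3 ?n (cross3 V ?n)"
    unfolding Lagrange[of ?n V ?n] using perp cross_norm_sq[of x y]
    by (simp add: \<Delta>_def power2_norm_eq_inner)
  also have "cross3 V ?n = (V \<bullet> y) *\<^sub>R x - (V \<bullet> x) *\<^sub>R y" by (rule Lagrange)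
  also have "cross3 ?n \<dots> = - cross3 \<dots> ?n" by (rule cross_skew)
  also have "\<dots> = (V \<bullet> x) *\<^sub>R cross3 y ?n - (V \<bullet> y) *\<^sub>R cross3 x ?n"
    by (simp add: Cross3.left_diff_distrib cross_mult_left)
  also have "\<dots> = ((V \<bullet> x) * (y \<bullet> y) - (V \<bullet> y) * (x \<bullet> y)) *\<^sub>R x + ((V \<bullet> y) * (x \<bullet> x) - (V \<bullet> x) * (x \<bullet> y)) *\<^sub>R y"
    unfolding Lagrange by (simp add: algebra_simps inner_commute)
  finally have "inverse \<Delta> *\<^sub>R (\<Delta> *\<^sub>R V) = inverse \<Delta> *\<^sub>R
      (((V \<bullet> x) * (y \<bullet> y) - (V \<bullet> y) * (x \<bullet> y)) *\<^sub>R x + ((V \<bullet> y) * (x \<bullet> x) - (V \<bullet> x) * (x \<bullet> y)) *\<^sub>R y)"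
    by simp
  then show ?thesis using nz by (simp add: scaleR_add_right divide_inverse mult.commute)
qed

text \<open>With E, F, G the first fundamental form of an immersion x, this is G x_uu - 2 F x_uv + E
  x_vv. Its normal component is the numerator of the mean curvature; up to the determinant of the
  metric it is the second order part of the Laplacian of x.\<close>

definition acceleration :: "(real \<times> real \<Rightarrow> real^3) \<Rightarrow> real \<times> real \<Rightarrow> real^3" where
  "acceleration F p = (pv F p \<bullet> pv F p) *\<^sub>R pu (pu F) p - (2 * (pu F p \<bullet> pv F p)) *\<^sub>R pv (pu F) p
     + (pu F p \<bullet> pu F p) *\<^sub>R pv (pv F) p"

lemma minimal_acceleration_tangent:
  assumes nz: "cross3 (pu F p) (pv F p) \<noteq> 0" and mc: "mean_curvature F p = 0"
  shows "cross3 (pu F p) (pv F p) \<bullet> acceleration F p = 0"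
proof -
  let ?n = "cross3 (pu F p) (pv F p)"
  let ?\<Delta> = "(pu F p \<bullet> pu F p) * (pv F p \<bullet> pv F p) - (pu F p \<bullet> pv F p)\<^sup>2"
  have \<Delta>: "?\<Delta> \<noteq> 0" using nz cross_norm_sq[of "pu F p" "pv F p"] by (metis norm_eq_zero power_eq_0_iff)
  have "(unit_normal F p \<bullet> acceleration F p) / (2 * ?\<Delta>) = mean_curvature F p"
    unfolding mean_curvature_def acceleration_def Let_def
    by (simp add: inner_add_right inner_diff_right inner_commute algebra_simps)
  then have "unit_normal F p \<bullet> acceleration F p = 0" using mc \<Delta> by simp
  then show ?thesis using nz by (simp add: unit_normal_def)
qed

text \<open>Minimality makes \<open>acceleration F p\<close> a combination of \<open>pu F p\<close>
  and \<open>pv F p\<close>; the product with \<open>k\<close> is the equation. Its principal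
  coefficients come from the first fundamental form, so ellipticity amounts to being an
  immersion.\<close>

lemma minimal_immersion_elliptic:
  fixes F :: "real \<times> real \<Rightarrow> real^3"
  assumes W: "open W" and sm: "smooth_on W F" and D: "D \<subseteq> W"
    and imm: "\<And>p. p \<in> D \<Longrightarrow> inj (frechet_derivative F (at p))"
    and mc: "\<And>p. p \<in> D \<Longrightarrow> mean_curvature F p = 0"
  shows "\<exists>a b. elliptic_solution D (\<lambda>p. k \<bullet> F p) (\<lambda>p. k \<bullet> pu F p) (\<lambda>p. k \<bullet> pv F p)
     (\<lambda>p. k \<bullet> pu (pu F) p) (\<lambda>p. k \<bullet> pv (pu F) p) (\<lambda>p. k \<bullet> pv (pv F) p)
     (\<lambda>p. pv F p \<bullet> pv F p) (\<lambda>p. pu F p \<bullet> pv F p) (\<lambda>p. pu F p \<bullet> pu F p) a b"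
proof -
  note s1 = smooth_on_partials[OF sm]
  note s2 = smooth_on_partials[OF s1(1)] smooth_on_partials[OF s1(2)]
  note c = smooth_on_continuous[OF s1(1), THEN continuous_on_subset, OF D]
    smooth_on_continuous[OF s1(2), THEN continuous_on_subset, OF D]
    smooth_on_continuous[OF s2(1), THEN continuous_on_subset, OF D]
    smooth_on_continuous[OF s2(2), THEN continuous_on_subset, OF D]
    smooth_on_continuous[OF s2(4), THEN continuous_on_subset, OF D]
  define \<Delta> where "\<Delta> p = (pu F p \<bullet> pu F p) * (pv F p \<bullet> pv F p) - (pu F p \<bullet> pv F p)\<^sup>2" for p
  have nz: "cross3 (pu F p) (pv F p) \<noteq> 0" if "p \<in> D" for p
    using immersion_cross_nonzero smooth_on_differentiable[OF sm] imm D that by blast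
  have \<Delta>: "0 < \<Delta> p" if "p \<in> D" for p
    using nz[OF that] cross_norm_sq[of "pu F p" "pv F p"] unfolding \<Delta>_def
    by (metis zero_less_power2 norm_eq_zero)
  define a where "a p = ((acceleration F p \<bullet> pu F p) * (pv F p \<bullet> pv F p)
      - (acceleration F p \<bullet> pv F p) * (pu F p \<bullet> pv F p)) / \<Delta> p" for p
  define b where "b p = ((acceleration F p \<bullet> pv F p) * (pu F p \<bullet> pu F p)
      - (acceleration F p \<bullet> pu F p) * (pu F p \<bullet> pv F p)) / \<Delta> p" for p
  have acc: "acceleration F p = a p *\<^sub>R pu F p + b p *\<^sub>R pv F p" if "p \<in> D" for p
    using tangent_decomposition[OF minimal_acceleration_tangent[OF nz[OF that] mc[OF that]]] \<Delta>[OF that]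
    unfolding a_def b_def \<Delta>_def by simp
  have ca: "continuous_on D (acceleration F)"
    unfolding acceleration_def[abs_def] by (intro continuous_intros c)
  have c\<Delta>: "continuous_on D \<Delta>"
    unfolding \<Delta>_def[abs_def] by (intro continuous_intros c)
  have pW: "p \<in> W" if "p \<in> D" for p using D that by blast
  have mixed: "k \<bullet> pu (pv F) p = k \<bullet> pv (pu F) p" if "p \<in> D" for p
    by (rule mixed_partials_commute[OF W pW[OF that] smooth_has_derivative_inner[OF sm]
          smooth_has_derivative_inner[OF s1(1) pW[OF that]]
          smooth_has_derivative_inner[OF s1(2) pW[OF that]]])
  have "elliptic_solution D (\<lambda>p. k \<bullet> F p) (\<lambda>p. k \<bullet> pu F p) (\<lambda>p. k \<bullet> pv F p)
     (\<lambda>p. k \<bullet> pu (pu F) p) (\<lambda>p. k \<bullet> pv (pu F) p) (\<lambda>p. k \<bullet> pv (pv F) p)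
     (\<lambda>p. pv F p \<bullet> pv F p) (\<lambda>p. pu F p \<bullet> pv F p) (\<lambda>p. pu F p \<bullet> pu F p) a b"
  proof
    fix p assume p: "p \<in> D"
    show "((\<lambda>p. k \<bullet> F p) has_derivative (\<lambda>h. k \<bullet> pu F p * fst h + k \<bullet> pv F p * snd h)) (at p)"
      by (rule smooth_has_derivative_inner[OF sm pW[OF p]])
    show "((\<lambda>p. k \<bullet> pu F p) has_derivative (\<lambda>h. k \<bullet> pu (pu F) p * fst h + k \<bullet> pv (pu F) p * snd h)) (at p)"
      by (rule smooth_has_derivative_inner[OF s1(1) pW[OF p]])
    show "((\<lambda>p. k \<bullet> pv F p) has_derivative (\<lambda>h. k \<bullet> pv (pu F) p * fst h + k \<bullet> pv (pv F) p * snd h)) (at p)"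
      using smooth_has_derivative_inner[OF s1(2) pW[OF p], of k] mixed[OF p] by simp
    show "(pu F p \<bullet> pv F p)\<^sup>2 < pv F p \<bullet> pv F p * (pu F p \<bullet> pu F p)"
      using \<Delta>[OF p] by (simp add: \<Delta>_def mult.commute)
    show "0 < pv F p \<bullet> pv F p" using nz[OF p] by auto
    have "k \<bullet> acceleration F p = k \<bullet> (a p *\<^sub>R pu F p + b p *\<^sub>R pv F p)" using acc[OF p] by simp
    then show "pv F p \<bullet> pv F p * (k \<bullet> pu (pu F) p) - 2 * (pu F p \<bullet> pv F p) * (k \<bullet> pv (pu F) p)
        + pu F p \<bullet> pu F p * (k \<bullet> pv (pv F) p) = a p * (k \<bullet> pu F p) + b p * (k \<bullet> pv F p)"
      by (simp add: acceleration_def inner_add_right inner_diff_right)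
  next
    show "continuous_on D a" "continuous_on D b"
      unfolding a_def[abs_def] b_def[abs_def] by (intro continuous_intros c ca c\<Delta> ballI; use \<Delta> in force)+
  qed (intro continuous_intros c)+
  then show ?thesis by blast
qed

text \<open>One interior contact makes the function constant by the strong maximum principle.
  Otherwise \<open>p0\<close> lies on the edge, where Hopf's lemma gives the normal derivative and
  maximality along the edge the tangential one. The strict inequality off the edge is kept because
  it later shows that the locally constant part is closed.\<close>

lemma half_ball_dichotomy:
  fixes F :: "real \<times> real \<Rightarrow> real^3"
  assumes W: "open W" and sm: "smooth_on W F" and DW: "ball p0 r \<inter> upper_half \<subseteq> W"
    and r: "0 < r" and p0: "0 \<le> snd p0"
    and imm: "\<And>p. p \<in> ball p0 r \<inter> upper_half \<Longrightarrow> inj (frechet_derivative F (at p))"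
    and mc: "\<And>p. p \<in> ball p0 r \<inter> upper_half \<Longrightarrow> mean_curvature F p = 0"
    and le: "\<And>p. p \<in> ball p0 r \<inter> upper_half \<Longrightarrow> k \<bullet> F p \<le> M"
    and eq: "k \<bullet> F p0 = M"
  shows "(\<forall>p \<in> ball p0 r \<inter> upper_half. k \<bullet> F p = M) \<or>
    (snd p0 = 0 \<and> k \<bullet> pu F p0 = 0 \<and> k \<bullet> pv F p0 < 0 \<and> (\<forall>p \<in> ball p0 r. 0 < snd p \<longrightarrow> k \<bullet> F p < M))"
proof -
  define D where "D = ball p0 r \<inter> upper_half"
  define H where "H = ball p0 r \<inter> {p. 0 < snd p}"
  have HD: "H \<subseteq> D" by (auto simp: H_def D_def upper_half_def)
  have half: "{p :: real \<times> real. 0 < snd p} = UNIV \<times> {0<..}" by auto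
  have H: "open H" "connected H"
    unfolding H_def half
    by (auto intro!: open_Int open_Times convex_connected convex_Int convex_Times)
  have p0D: "p0 \<in> D" using r p0 by (simp add: D_def upper_half_def)
  obtain a b where "elliptic_solution D (\<lambda>p. k \<bullet> F p) (\<lambda>p. k \<bullet> pu F p) (\<lambda>p. k \<bullet> pv F p)
     (\<lambda>p. k \<bullet> pu (pu F) p) (\<lambda>p. k \<bullet> pv (pu F) p) (\<lambda>p. k \<bullet> pv (pv F) p)
     (\<lambda>p. pv F p \<bullet> pv F p) (\<lambda>p. pu F p \<bullet> pv F p) (\<lambda>p. pu F p \<bullet> pu F p) a b"
    using minimal_immersion_elliptic[OF W sm DW imm mc] unfolding D_def by blast
  then interpret elliptic_solution D "\<lambda>p. k \<bullet> F p" "\<lambda>p. k \<bullet> pu F p" "\<lambda>p. k \<bullet> pv F p"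
     "\<lambda>p. k \<bullet> pu (pu F) p" "\<lambda>p. k \<bullet> pv (pu F) p" "\<lambda>p. k \<bullet> pv (pv F) p"
     "\<lambda>p. pv F p \<bullet> pv F p" "\<lambda>p. pu F p \<bullet> pv F p" "\<lambda>p. pu F p \<bullet> pu F p" a b .
  have up: "p + (0, t) \<in> H" if "p \<in> D" "0 < t" "t < r - dist p0 p" for p t
  proof -
    have "dist p0 (p + (0, t)) \<le> dist p0 p + dist p (p + (0, t))" by (rule dist_triangle)
    also have "dist p (p + (0, t)) = t" using that by (simp add: dist_norm)
    finally show ?thesis using that by (simp add: H_def D_def upper_half_def)
  qed
  show ?thesis
  proof (cases "\<exists>p\<in>H. k \<bullet> F p = M")
    case True
    then have HM: "k \<bullet> F p = M" if "p \<in> H" for p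
      using strong_maximum_principle[OF H HD, of M] le that HD unfolding D_def by blast
    have "k \<bullet> F p = M" if p: "p \<in> D" for p
    proof -
      have rp: "0 < r - dist p0 p" using p by (simp add: D_def)
      \<comment> \<open>Edge points are limits of the points straight above them, where the value is
        already known.\<close>
      have "((\<lambda>t. k \<bullet> F (p + t *\<^sub>R (0, 1))) has_real_derivative (k \<bullet> pv F p)) (at 0)"
        using has_real_derivative_along_line[of "\<lambda>p. k \<bullet> F p" "k \<bullet> pu F p" "k \<bullet> pv F p" p 0 "(0, 1)"]
          du[OF p] by (simp flip: zero_prod_def)
      then have "isCont (\<lambda>t. k \<bullet> F (p + t *\<^sub>R (0, 1))) 0" by (rule DERIV_isCont)
      then have "((\<lambda>t. k \<bullet> F (p + t *\<^sub>R (0, 1))) \<longlongrightarrow> k \<bullet> F p) (at_right 0)"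
        by (auto simp: isCont_def simp flip: zero_prod_def intro: tendsto_within_subset)
      moreover have "\<forall>\<^sub>F t in at_right 0. k \<bullet> F (p + t *\<^sub>R (0, 1)) = M"
        unfolding eventually_at_right_field
        by (intro exI[of _ "r - dist p0 p"] conjI allI impI rp) (simp add: HM up[OF p])
      then have "((\<lambda>t. k \<bullet> F (p + t *\<^sub>R (0, 1))) \<longlongrightarrow> M) (at_right 0)" by (rule tendsto_eventually)
      ultimately show ?thesis using tendsto_unique[OF trivial_limit_at_right_real] by blast
    qed
    then show ?thesis by (simp add: D_def)
  next
    case False
    then have less: "k \<bullet> F p < M" if "p \<in> H" for p
      using le[of p] that HD unfolding D_def by (meson order_le_less subsetD)
    have s0: "snd p0 = 0"
    proof (rule ccontr)
      assume "snd p0 \<noteq> 0"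
      then have "p0 \<in> H" using p0 r by (simp add: H_def)
      then show False using less[of p0] eq by simp
    qed
    \<comment> \<open>The disc of radius \<open>R\<close> about \<open>p0 + (0, R)\<close> touches
      the edge from above at \<open>p0\<close>, and \<open>2 * R < r\<close> keeps it inside the
      half ball.\<close>
    define R where "R = r / 3"
    have R: "0 < R" "2 * R < r" using r by (auto simp: R_def)
    define y where "y = p0 + (0, R)"
    have dy: "dist p0 y = R" "snd y = R" "y - p0 = (0, R)" using R s0 by (auto simp: y_def dist_norm)
    have zD: "z \<in> ball p0 r" if "dist y z \<le> R" for z
      using dist_triangle[of p0 z y] that dy R by simp
    have zs: "R - snd z \<le> dist y z" for z
      using dist_snd_le[of y z] dy by (simp add: dist_real_def)
    have "k \<bullet> pu F p0 * fst (y - p0) + k \<bullet> pv F p0 * snd (y - p0) < 0"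
    proof (rule Hopf_lemma[OF R(1)])
      show "cball y R \<subseteq> D"
      proof
        fix z assume "z \<in> cball y R"
        then show "z \<in> D" using zD[of z] zs[of z] by (simp add: D_def upper_half_def)
      qed
      then show "k \<bullet> F z \<le> M" if "z \<in> cball y R" for z using le that unfolding D_def by blast
      show "k \<bullet> F z < M" if "z \<in> ball y R" for z
        using less[of z] zD[of z] zs[of z] that by (simp add: H_def)
    qed (use dy eq in \<open>auto simp: dist_commute\<close>)
    then have pv: "k \<bullet> pv F p0 < 0" using dy R by (simp add: mult_less_0_iff)
    have "((\<lambda>t. k \<bullet> F (p0 + t *\<^sub>R (1, 0))) has_real_derivative (k \<bullet> pu F p0)) (at 0)"
      using has_real_derivative_along_line[of "\<lambda>p. k \<bullet> F p" "k \<bullet> pu F p0" "k \<bullet> pv F p0" p0 0 "(1, 0)"]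
        du[OF p0D] by (simp flip: zero_prod_def)
    from DERIV_local_max[OF this r] have pu: "k \<bullet> pu F p0 = 0"
      using eq le s0 by (simp add: dist_norm upper_half_def flip: zero_prod_def)
    show ?thesis using s0 pu pv less unfolding H_def by blast
  qed
qed

section \<open>Charts and transition maps\<close>

lemma surface_chartD:
  assumes "surface_chart S U \<psi>"
  shows surface_chart_open: "openin S U"
    and surface_chart_upper_half: "x \<in> U \<Longrightarrow> \<psi> x \<in> upper_half"
    and surface_chart_inj: "inj_on \<psi> U"
proof -
  show U: "openin S U" using assms by (simp add: surface_chart_def)
  show "\<psi> x \<in> upper_half" if "x \<in> U"
    using assms that openin_imp_subset unfolding surface_chart_def by blast
  show "inj_on \<psi> U"
    using assms homeomorphic_imp_injective_map[of "subtopology S U" _ \<psi>] openin_subset[OF U]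
    unfolding surface_chart_def by (metis topspace_subtopology_subset)
qed

lemma surface_chart_preimage_open:
  assumes ch: "surface_chart S U \<psi>" and V: "open V"
  shows "openin S {y \<in> U. \<psi> y \<in> V}"
proof -
  have U: "openin S U" by (rule surface_chart_open[OF ch])
  have "continuous_map (subtopology S U) (top_of_set (\<psi> ` U)) \<psi>"
    using ch by (auto simp: surface_chart_def homeomorphic_imp_continuous_map)
  then have "continuous_map (subtopology S U) euclidean \<psi>"
    by (simp add: continuous_map_in_subtopology)
  then have "openin (subtopology S U) {y \<in> topspace (subtopology S U). \<psi> y \<in> V}"
    using V by (intro openin_continuous_map_preimage) auto
  moreover have "{y \<in> topspace (subtopology S U). \<psi> y \<in> V} = {y \<in> U. \<psi> y \<in> V}"
    using openin_subset[OF U] by auto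
  ultimately show ?thesis using openin_trans_full[OF _ U] by metis
qed

lemma surface_chart_image_ball:
  assumes ch: "surface_chart S U \<psi>" and N: "openin S N" and x: "x \<in> U" "x \<in> N"
  obtains r where "0 < r" "ball (\<psi> x) r \<inter> upper_half \<subseteq> \<psi> ` (U \<inter> N)"
proof -
  have U: "openin S U" by (rule surface_chart_open[OF ch])
  have "open_map (subtopology S U) (top_of_set (\<psi> ` U)) \<psi>"
    using ch by (auto simp: surface_chart_def homeomorphic_imp_open_map)
  moreover have "openin (subtopology S U) (U \<inter> N)"
    using N by (simp add: openin_subtopology_Int2)
  ultimately have "openin (top_of_set (\<psi> ` U)) (\<psi> ` (U \<inter> N))" by (simp add: open_map_def)
  moreover have "openin (top_of_set upper_half) (\<psi> ` U)" using ch by (simp add: surface_chart_def)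
  ultimately have "openin (top_of_set upper_half) (\<psi> ` (U \<inter> N))" by (rule openin_trans)
  then show ?thesis using x that unfolding openin_contains_ball by blast
qed

section \<open>Comparison of two charts through the immersion\<close>

text \<open>\<open>y\<close> is only known to be continuous. A relative error of at most 1/2 in
  \<open>G\<close> can be absorbed on the left, which gives the Lipschitz bound
  \<open>2 * K * \<bar>t\<bar>\<close>; with it the factor \<open>e / (4 * K)\<close> turns the
  error into \<open>e / 2 * \<bar>t\<bar>\<close>.\<close>

lemma has_vector_derivative_inverse_curve:
  fixes y :: "real \<Rightarrow> 'a::real_normed_vector"
  assumes G: "(G has_derivative (\<lambda>h. h)) (at (y 0))"
    and y: "continuous (at 0 within T) y"
    and Gy: "((\<lambda>t. G (y t)) has_vector_derivative w) (at 0 within T)"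
  shows "(y has_vector_derivative w) (at 0 within T)"
  unfolding has_vector_derivative_def has_derivative_within_alt
proof (intro conjI allI impI)
  show "bounded_linear (\<lambda>x. x *\<^sub>R w)" by (rule bounded_linear_scaleR_left)
  fix e :: real assume e: "0 < e"
  define K where "K = norm w + 1"
  have K: "0 < K" by (simp add: K_def add_nonneg_pos)
  define e1 where "e1 = min (1/2) (e / (4 * K))"
  define e2 where "e2 = min 1 (e / 2)"
  have e12: "0 < e1" "0 < e2" using e K by (auto simp: e1_def e2_def)
  obtain \<eta> where \<eta>: "0 < \<eta>" "\<And>p. norm (p - y 0) < \<eta> \<Longrightarrow> norm (G p - G (y 0) - (p - y 0)) \<le> e1 * norm (p - y 0)"
    using G e12(1) unfolding has_derivative_at_alt by blast
  obtain d1 where d1: "0 < d1" "\<And>t. t \<in> T \<Longrightarrow> norm (t - 0) < d1 \<Longrightarrow> norm (y t - y 0) < \<eta>"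
    using y \<eta>(1) unfolding continuous_within_eps_delta dist_norm by blast
  obtain d2 where d2: "0 < d2" "\<And>t. t \<in> T \<Longrightarrow> norm (t - 0) < d2 \<Longrightarrow> norm (G (y t) - G (y 0) - (t - 0) *\<^sub>R w) \<le> e2 * norm (t - 0)"
    using Gy e12(2) unfolding has_vector_derivative_def has_derivative_within_alt by blast
  have "norm (y t - y 0 - (t - 0) *\<^sub>R w) \<le> e * norm (t - 0)"
    if t: "t \<in> T" "norm (t - 0) < min d1 d2" for t
  proof -
    define n where "n = norm (y t - y 0)"
    have a: "norm (G (y t) - G (y 0) - (y t - y 0)) \<le> e1 * n"
      unfolding n_def by (rule \<eta>(2)) (use d1(2) t in auto)
    have b: "norm (G (y t) - G (y 0) - t *\<^sub>R w) \<le> e2 * \<bar>t\<bar>" using d2(2)[OF t(1)] t(2) by auto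
    have "norm (y t - y 0 - t *\<^sub>R w) \<le> norm (G (y t) - G (y 0) - t *\<^sub>R w) + norm (G (y t) - G (y 0) - (y t - y 0))"
      using norm_triangle_ineq4[of "G (y t) - G (y 0) - t *\<^sub>R w" "G (y t) - G (y 0) - (y t - y 0)"]
      by (simp add: algebra_simps)
    then have c: "norm (y t - y 0 - t *\<^sub>R w) \<le> e2 * \<bar>t\<bar> + e1 * n" using a b by simp
    have n0: "0 \<le> n" by (simp add: n_def)
    have "n \<le> norm (y t - y 0 - t *\<^sub>R w) + \<bar>t\<bar> * norm w"
      using norm_triangle_ineq[of "y t - y 0 - t *\<^sub>R w" "t *\<^sub>R w"] by (simp add: n_def)
    moreover have "e1 * n \<le> 1/2 * n" using n0 by (intro mult_right_mono) (auto simp: e1_def)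
    moreover have "e2 * \<bar>t\<bar> \<le> 1 * \<bar>t\<bar>" by (intro mult_right_mono) (auto simp: e2_def)
    ultimately have "n \<le> 2 * K * \<bar>t\<bar>" using c by (simp add: K_def algebra_simps)
    then have "e1 * n \<le> e / (4 * K) * (2 * K * \<bar>t\<bar>)"
      using n0 e K by (intro mult_mono) (auto simp: e1_def)
    also have "\<dots> = e / 2 * \<bar>t\<bar>" using K by simp
    finally have "e1 * n \<le> e / 2 * \<bar>t\<bar>" .
    moreover have "e2 * \<bar>t\<bar> \<le> e / 2 * \<bar>t\<bar>" by (intro mult_right_mono) (auto simp: e2_def)
    ultimately show ?thesis using c by simp
  qed
  then show "\<exists>d>0. \<forall>y'\<in>T. norm (y' - 0) < d \<longrightarrow> norm (y y' - y 0 - (y' - 0) *\<^sub>R w) \<le> e * norm (y' - 0)"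
    using d1(1) d2(1) by (intro exI[of _ "min d1 d2"]) auto
qed

text \<open>Chart changes are mere homeomorphisms; differentiability comes from the fact that both
  representatives describe \<open>\<phi>\<close>. A left inverse of the derivative of
  \<open>F2\<close> reduces to a map with identity derivative. The segment is followed for
  nonnegative times only, since it may start on the edge; its image never leaves the upper
  half-plane, hence the sign of \<open>snd w'\<close>.\<close>

lemma transition_vector:
  fixes \<phi> :: "'a \<Rightarrow> real^3"
  assumes ch1: "surface_chart S U1 \<psi>1" and ch2: "surface_chart S U2 \<psi>2"
    and rep1: "local_rep \<phi> U1 \<psi>1 W1 F1" and rep2: "local_rep \<phi> U2 \<psi>2 W2 F2"
    and x: "x \<in> U1" "x \<in> U2" and inj: "inj (frechet_derivative F2 (at (\<psi>2 x)))"
    and e: "0 < e" "\<And>t. 0 \<le> t \<Longrightarrow> t < e \<Longrightarrow> \<psi>1 x + t *\<^sub>R w \<in> upper_half"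
  obtains w' where "frechet_derivative F1 (at (\<psi>1 x)) w = frechet_derivative F2 (at (\<psi>2 x)) w'"
    and "snd (\<psi>2 x) = 0 \<Longrightarrow> 0 \<le> snd w'"
proof -
  define g where "g t = inv_into U1 \<psi>1 (\<psi>1 x + t *\<^sub>R w)" for t
  define y where "y t = \<psi>2 (g t)" for t
  note inj1 = surface_chart_inj[OF ch1]
  have g_near: "\<exists>d>0. d \<le> e \<and> (\<forall>t. 0 \<le> t \<and> t < d \<longrightarrow> g t \<in> U1 \<inter> N \<and> \<psi>1 (g t) = \<psi>1 x + t *\<^sub>R w)"
    if N: "openin S N" "x \<in> N" for N
  proof -
    obtain r where r: "0 < r" "ball (\<psi>1 x) r \<inter> upper_half \<subseteq> \<psi>1 ` (U1 \<inter> N)"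
      using surface_chart_image_ball[OF ch1 N(1) x(1) N(2)] .
    define d where "d = min e (r / (norm w + 1))"
    have d: "0 < d" "d \<le> e" using e(1) r(1) by (auto simp: d_def add_nonneg_pos)
    have "g t \<in> U1 \<inter> N \<and> \<psi>1 (g t) = \<psi>1 x + t *\<^sub>R w" if t: "0 \<le> t" "t < d" for t
    proof -
      have "t * (norm w + 1) < r"
        using t pos_less_divide_eq[of "norm w + 1" t r] by (auto simp: d_def add_nonneg_pos)
      then have "norm (t *\<^sub>R w) < r" using t by (simp add: algebra_simps)
      then have "\<psi>1 x + t *\<^sub>R w \<in> ball (\<psi>1 x) r" by (simp add: dist_norm)
      then have "\<psi>1 x + t *\<^sub>R w \<in> \<psi>1 ` (U1 \<inter> N)" using r(2) e(2)[of t] t d by auto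
      then show ?thesis using inj1 by (auto simp: g_def)
    qed
    then show ?thesis using d by blast
  qed
  have g0: "g 0 = x" using inj1 x by (simp add: g_def)
  then have y0: "y 0 = \<psi>2 x" by (simp add: y_def)
  obtain d where d: "0 < d" "\<And>t. 0 \<le> t \<Longrightarrow> t < d \<Longrightarrow> g t \<in> U1 \<inter> U2 \<and> \<psi>1 (g t) = \<psi>1 x + t *\<^sub>R w"
    using g_near[OF surface_chart_open[OF ch2] x(2)] by blast
  define T where "T = {0..<d}"
  have T0: "0 \<in> T" using d by (simp add: T_def)
  have F12: "F2 (y t) = F1 (\<psi>1 x + t *\<^sub>R w)" if "t \<in> T" for t
  proof -
    have "g t \<in> U1 \<inter> U2" "\<psi>1 (g t) = \<psi>1 x + t *\<^sub>R w" using d(2) that by (auto simp: T_def)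
    then show ?thesis using rep1 rep2 unfolding local_rep_def y_def by (metis IntD1 IntD2)
  qed
  have cont: "continuous (at 0 within T) y"
    unfolding continuous_within_eps_delta
  proof (intro allI impI)
    fix \<epsilon> :: real assume "0 < \<epsilon>"
    define N where "N = {z \<in> U2. \<psi>2 z \<in> ball (\<psi>2 x) \<epsilon>}"
    have "openin S N" unfolding N_def by (rule surface_chart_preimage_open[OF ch2]) simp
    moreover have "x \<in> N" using x \<open>0 < \<epsilon>\<close> by (simp add: N_def)
    ultimately obtain d' where "0 < d'" "\<And>t. 0 \<le> t \<Longrightarrow> t < d' \<Longrightarrow> g t \<in> N" using g_near by blast
    then show "\<exists>d>0. \<forall>x'\<in>T. dist x' 0 < d \<longrightarrow> dist (y x') (y 0) < \<epsilon>"
      by (intro exI[of _ d']) (auto simp: T_def N_def y_def g0 dist_commute)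
  qed
  have D1: "(F1 has_derivative frechet_derivative F1 (at (\<psi>1 x))) (at (\<psi>1 x))"
    and D2: "(F2 has_derivative frechet_derivative F2 (at (\<psi>2 x))) (at (\<psi>2 x))"
    using rep1 rep2 x smooth_on_differentiable[of W1 F1 "\<psi>1 x"] smooth_on_differentiable[of W2 F2 "\<psi>2 x"]
    unfolding local_rep_def by (auto simp: image_subset_iff simp flip: frechet_derivative_works)
  have line: "((\<lambda>t. F1 (\<psi>1 x + t *\<^sub>R w)) has_vector_derivative frechet_derivative F1 (at (\<psi>1 x)) w) (at 0 within T)"
  proof -
    have "((\<lambda>t. \<psi>1 x + t *\<^sub>R w) has_vector_derivative w) (at 0 within T)"
      by (auto intro!: derivative_eq_intros)
    from vector_derivative_diff_chain_within[OF this, of F1 "frechet_derivative F1 (at (\<psi>1 x))"] D1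
    show ?thesis by (simp add: o_def has_derivative_at_withinI)
  qed
  obtain L where L: "linear L" "L \<circ> frechet_derivative F2 (at (\<psi>2 x)) = id"
    using linear_injective_left_inverse[OF has_derivative_linear[OF D2] inj] by blast
  have bL: "bounded_linear L" using L(1) linear_conv_bounded_linear by blast
  define w' where "w' = L (frechet_derivative F1 (at (\<psi>1 x)) w)"
  have "((\<lambda>p. L (F2 p)) has_derivative (\<lambda>h. L (frechet_derivative F2 (at (\<psi>2 x)) h))) (at (\<psi>2 x))"
    by (rule bounded_linear.has_derivative[OF bL D2])
  then have GD: "((\<lambda>p. L (F2 p)) has_derivative (\<lambda>h. h)) (at (y 0))"
    unfolding y0 by (rule has_derivative_eq_rhs) (use L(2) in \<open>metis comp_apply id_apply\<close>)
  have "((\<lambda>t. L (F1 (\<psi>1 x + t *\<^sub>R w))) has_vector_derivative w') (at 0 within T)"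
    unfolding w'_def by (rule bounded_linear.has_vector_derivative[OF bL line])
  then have "((\<lambda>t. L (F2 (y t))) has_vector_derivative w') (at 0 within T)"
    by (rule has_vector_derivative_transform[OF T0, rotated]) (simp add: F12)
  then have yD: "(y has_vector_derivative w') (at 0 within T)"
    by (rule has_vector_derivative_inverse_curve[OF GD cont])
  have nb: "at 0 within T \<noteq> bot"
  proof -
    have "at (0::real) within {0..d/2} \<le> at 0 within T" using d(1) by (intro at_le) (auto simp: T_def)
    then have "at_right 0 \<le> at (0::real) within T" using d(1) by (simp add: at_within_Icc_at_right)
    then show ?thesis using trivial_limit_at_right_real bot.extremum_uniqueI by metis
  qed
  show ?thesis
  proof
    have "((\<lambda>t. F2 (y t)) has_vector_derivative frechet_derivative F2 (at (\<psi>2 x)) w') (at 0 within T)"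
      using vector_derivative_diff_chain_within[OF yD, of F2 "frechet_derivative F2 (at (\<psi>2 x))"] D2
      by (simp add: o_def y0 has_derivative_at_withinI)
    then have "((\<lambda>t. F1 (\<psi>1 x + t *\<^sub>R w)) has_vector_derivative frechet_derivative F2 (at (\<psi>2 x)) w') (at 0 within T)"
      by (rule has_vector_derivative_transform[OF T0, rotated]) (simp add: F12)
    then show "frechet_derivative F1 (at (\<psi>1 x)) w = frechet_derivative F2 (at (\<psi>2 x)) w'"
      by (rule vector_derivative_unique_within[OF nb line])
    assume s0: "snd (\<psi>2 x) = 0"
    have "((\<lambda>t. snd (y t)) has_vector_derivative snd w') (at 0 within T)"
      by (rule bounded_linear.has_vector_derivative[OF bounded_linear_snd yD])
    then have "((\<lambda>t. (snd (y t) - snd (y 0)) / (t - 0)) \<longlongrightarrow> snd w') (at 0 within T)"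
      by (simp add: has_real_derivative_iff_has_vector_derivative[symmetric] has_field_derivative_iff)
    moreover have "\<forall>\<^sub>F t in at 0 within T. 0 \<le> (snd (y t) - snd (y 0)) / (t - 0)"
    proof -
      have "0 \<le> snd (y t)" if "t \<in> T" for t
        using surface_chart_upper_half[OF ch2, of "g t"] d(2)[of t] that
        by (auto simp: T_def y_def upper_half_def)
      then show ?thesis unfolding eventually_at
        by (intro exI[of _ 1]) (auto simp: y0 s0 T_def)
    qed
    ultimately show "0 \<le> snd w'" using nb by (rule tendsto_lowerbound)
  qed
qed

section \<open>Closed plane curves\<close>

locale closed_curve =
  fixes \<gamma> :: "real \<Rightarrow> real^2"
  assumes curve: "smooth_simple_closed_curve \<gamma>"
begin

lemma periodic_int: "\<gamma> (t + of_int n) = \<gamma> t"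
proof -
  have per: "\<gamma> (t + 1) = \<gamma> t" for t using curve by (simp add: smooth_simple_closed_curve_def)
  have nat: "\<gamma> (t + of_nat k) = \<gamma> t" for t k
  proof (induction k)
    case (Suc k)
    have "\<gamma> (t + of_nat (Suc k)) = \<gamma> ((t + of_nat k) + 1)" by (simp add: algebra_simps)
    then show ?case using per Suc by simp
  qed simp
  show ?thesis
  proof (cases "0 \<le> n")
    case True
    then show ?thesis using nat[of t "nat n"] by simp
  next
    case False
    then show ?thesis using nat[of "t + of_int n" "nat (- n)"] by simp
  qed
qed

lemma derivative: "(\<gamma> has_vector_derivative vector_derivative \<gamma> (at t)) (at t)"
  using curve smooth_on_differentiable[of UNIV \<gamma> t]
  by (simp add: smooth_simple_closed_curve_def flip: vector_derivative_works)

lemma derivative_nonzero: "vector_derivative \<gamma> (at t) \<noteq> 0"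
  using curve by (simp add: smooth_simple_closed_curve_def)

lemma continuous_derivative: "continuous_on UNIV (\<lambda>t. vector_derivative \<gamma> (at t))"
proof -
  have sm: "smooth_on UNIV \<gamma>" using curve by (simp add: smooth_simple_closed_curve_def)
  have "vector_derivative \<gamma> (at t) = frechet_derivative \<gamma> (at t) 1" for t
    using frechet_derivative_eq_vector_derivative[OF smooth_on_differentiable[OF sm, of t]] by simp
  then show ?thesis using smooth_on_continuous[OF smooth_on_frechet[OF sm, of 1]] by simp
qed

lemma continuous: "continuous_on A \<gamma>"
  by (meson derivative continuous_at_imp_continuous_on has_vector_derivative_continuous)

lemma eq_imp_integer_difference:
  assumes "\<gamma> s = \<gamma> t"
  shows "s - t \<in> \<int>"
proof -
  have fr: "\<gamma> (frac s) = \<gamma> s" for s using periodic_int[of "frac s" "\<lfloor>s\<rfloor>"] by (simp add: frac_def)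
  have "frac s = frac t"
    using curve fr[of s] fr[of t] assms frac_ge_0 frac_lt_1 unfolding smooth_simple_closed_curve_def
    by (metis atLeastLessThan_iff inj_onD)
  then have "s - t = of_int (\<lfloor>s\<rfloor> - \<lfloor>t\<rfloor>)" by (simp add: frac_def algebra_simps)
  then show ?thesis by simp
qed

text \<open>The rest of a period is a compact arc that misses \<open>\<gamma> t0\<close> by
  injectivity, so it keeps a positive distance from that point.\<close>

lemma local_parameter:
  assumes e: "0 < e"
  shows "\<exists>\<delta>>0. \<forall>q \<in> range \<gamma>. dist q (\<gamma> t0) < \<delta> \<longrightarrow> (\<exists>t. \<bar>t - t0\<bar> < e \<and> q = \<gamma> t)"
proof -
  define e' where "e' = min e (1/2)"
  have e': "0 < e'" "e' \<le> e" using e by (auto simp: e'_def)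
  define K where "K = \<gamma> ` {t0 + e' .. t0 + 1 - e'}"
  have "closed K" unfolding K_def
    by (intro compact_imp_closed compact_continuous_image continuous) auto
  moreover have "\<gamma> t0 \<notin> K"
  proof
    assume "\<gamma> t0 \<in> K"
    then obtain s where s: "s \<in> {t0 + e' .. t0 + 1 - e'}" "\<gamma> s = \<gamma> t0" by (auto simp: K_def)
    then obtain n :: int where "s - t0 = of_int n" using eq_imp_integer_difference Ints_cases by metis
    moreover have "0 < s - t0" "s - t0 < 1" using s e' by auto
    ultimately show False by simp
  qed
  ultimately obtain \<delta> where \<delta>: "0 < \<delta>" "ball (\<gamma> t0) \<delta> \<subseteq> - K"
    using openE[of "- K" "\<gamma> t0"] by (auto simp: open_Compl)
  have "\<exists>t. \<bar>t - t0\<bar> < e \<and> q = \<gamma> t" if q: "q \<in> range \<gamma>" "dist q (\<gamma> t0) < \<delta>" for q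
  proof -
    obtain s where s: "q = \<gamma> s" using q by auto
    define s' where "s' = t0 + frac (s - t0)"
    have s': "q = \<gamma> s'" using periodic_int[of s' "\<lfloor>s - t0\<rfloor>"] by (simp add: s s'_def frac_def)
    have b: "t0 \<le> s'" "s' < t0 + 1" using frac_ge_0[of "s - t0"] frac_lt_1[of "s - t0"] by (auto simp: s'_def)
    have "q \<notin> K" using \<delta>(2) q(2) by (auto simp: dist_commute)
    then have "s' < t0 + e' \<or> t0 + 1 - e' < s'" using s' by (force simp: K_def)
    then show ?thesis
    proof
      assume "s' < t0 + e'"
      then show ?thesis using b e' s' by (intro exI[of _ s']) auto
    next
      assume "t0 + 1 - e' < s'"
      then show ?thesis using b e' s' periodic_int[of s' "-1"] by (intro exI[of _ "s' - 1"]) auto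
    qed
  qed
  then show ?thesis using \<delta>(1) by blast
qed

lemma image_unit_interval: "\<gamma> ` {0..1} = range \<gamma>"
proof -
  have "\<gamma> t \<in> \<gamma> ` {0..1}" for t
  proof -
    have "\<gamma> t = \<gamma> (frac t)" using periodic_int[of "frac t" "\<lfloor>t\<rfloor>"] by (simp add: frac_def)
    then show ?thesis using frac_ge_0[of t] frac_lt_1[of t] by auto
  qed
  then show ?thesis by auto
qed

text \<open>Tangency expressed through points of the curve alone, so that it applies to curves not
  known to factor differentiably through \<open>\<gamma>\<close>.\<close>

lemma normal_component_small:
  fixes t0 :: real and n :: "real^2"
  defines "d \<equiv> vector_derivative \<gamma> (at t0)"
  assumes n: "d \<bullet> n = 0" and e: "0 < e"
  shows "\<exists>\<delta>>0. \<forall>q \<in> range \<gamma>. dist q (\<gamma> t0) < \<delta> \<longrightarrow> \<bar>(q - \<gamma> t0) \<bullet> n\<bar> \<le> e * norm (q - \<gamma> t0)"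
proof -
  have d0: "0 < norm d" using derivative_nonzero by (simp add: d_def)
  \<comment> \<open>The first bound makes \<open>norm d / 2 * \<bar>t - t0\<bar>\<close> at most the
    distance travelled; the second then keeps the remainder times \<open>norm n\<close> below
    \<open>e\<close> times that distance.\<close>
  define k where "k = min (norm d / 2) (e * norm d / (2 * (norm n + 1)))"
  have nn: "0 < norm n + 1" by (simp add: add_nonneg_pos)
  have k: "0 < k" using d0 e nn by (auto simp: k_def)
  obtain \<eta> where \<eta>: "0 < \<eta>" "\<And>t. norm (t - t0) < \<eta> \<Longrightarrow> norm (\<gamma> t - \<gamma> t0 - (t - t0) *\<^sub>R d) \<le> k * norm (t - t0)"
    using derivative[of t0] k unfolding has_vector_derivative_def has_derivative_at_alt d_def by blast
  obtain \<delta> where \<delta>: "0 < \<delta>" "\<And>q. q \<in> range \<gamma> \<Longrightarrow> dist q (\<gamma> t0) < \<delta> \<Longrightarrow> (\<exists>t. \<bar>t - t0\<bar> < \<eta> \<and> q = \<gamma> t)"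
    using local_parameter[OF \<eta>(1)] by blast
  have "\<bar>(q - \<gamma> t0) \<bullet> n\<bar> \<le> e * norm (q - \<gamma> t0)" if q: "q \<in> range \<gamma>" "dist q (\<gamma> t0) < \<delta>" for q
  proof -
    obtain t where t: "\<bar>t - t0\<bar> < \<eta>" "q = \<gamma> t" using \<delta>(2)[OF q] by blast
    define r where "r = q - \<gamma> t0 - (t - t0) *\<^sub>R d"
    have r: "norm r \<le> k * \<bar>t - t0\<bar>" using \<eta>(2)[of t] t by (simp add: r_def)
    have "\<bar>t - t0\<bar> * norm d \<le> norm (q - \<gamma> t0) + norm r"
      using norm_triangle_ineq4[of "q - \<gamma> t0" r] by (simp add: r_def)
    moreover have "k * \<bar>t - t0\<bar> \<le> norm d / 2 * \<bar>t - t0\<bar>" by (intro mult_right_mono) (simp_all only: k_def min.cobounded1 abs_ge_zero)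
    ultimately have 1: "norm d / 2 * \<bar>t - t0\<bar> \<le> norm (q - \<gamma> t0)" using r by (simp add: mult.commute)
    have "(q - \<gamma> t0) \<bullet> n = r \<bullet> n" using n by (simp add: r_def inner_diff_left)
    then have "\<bar>(q - \<gamma> t0) \<bullet> n\<bar> \<le> norm r * norm n" by (simp add: Cauchy_Schwarz_ineq2)
    also have "\<dots> \<le> (k * \<bar>t - t0\<bar>) * (norm n + 1)" using r k by (intro mult_mono) auto
    also have "\<dots> \<le> (e * norm d / (2 * (norm n + 1)) * \<bar>t - t0\<bar>) * (norm n + 1)"
      using nn by (intro mult_right_mono) (simp_all only: k_def min.cobounded2 abs_ge_zero less_imp_le)
    also have "\<dots> = e * (norm d / 2 * \<bar>t - t0\<bar>)" using nn by (simp add: field_simps)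
    also have "\<dots> \<le> e * norm (q - \<gamma> t0)" using 1 e by (intro mult_left_mono) auto
    finally show ?thesis .
  qed
  then show ?thesis using \<delta>(1) by blast
qed

text \<open>Difference quotients of \<open>\<beta>\<close> are tested against the normal
  \<open>n\<close>: their normal part is at most any positive \<open>k\<close> times their length,
  and this passes to the limit \<open>v\<close>.\<close>

lemma velocity_parallel:
  fixes \<beta> :: "real \<Rightarrow> real^2"
  assumes \<beta>: "(\<beta> has_vector_derivative v) (at 0)" "\<beta> 0 = \<gamma> t0"
    and e: "0 < e" "\<And>s. \<bar>s\<bar> < e \<Longrightarrow> \<beta> s \<in> range \<gamma>"
  shows "\<exists>c. v = c *\<^sub>R vector_derivative \<gamma> (at t0)"
proof -
  define d where "d = vector_derivative \<gamma> (at t0)"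
  define n :: "real^2" where "n = vector [- (d$2), d$1]"
  have dn: "d \<bullet> n = 0" by (simp add: n_def inner_vec_def sum_2)
  have lim: "((\<lambda>s. (1/s) *\<^sub>R (\<beta> s - \<gamma> t0)) \<longlongrightarrow> v) (at 0)"
  proof -
    have "((\<lambda>s. (1 / norm (s - 0)) *\<^sub>R (\<beta> s - (\<beta> 0 + (s - 0) *\<^sub>R v))) \<longlongrightarrow> 0) (at 0)"
      using \<beta>(1) unfolding has_vector_derivative_def has_derivative_at2 by blast
    then have "((\<lambda>s. norm ((1 / norm (s - 0)) *\<^sub>R (\<beta> s - (\<beta> 0 + (s - 0) *\<^sub>R v)))) \<longlongrightarrow> 0) (at 0)"
      by (rule tendsto_norm_zero)
    moreover have "\<forall>\<^sub>F s in at 0. norm ((1 / norm (s - 0)) *\<^sub>R (\<beta> s - (\<beta> 0 + (s - 0) *\<^sub>R v)))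
        = norm ((1/s) *\<^sub>R (\<beta> s - \<gamma> t0) - v)"
    proof -
      have "norm ((1 / norm (s - 0)) *\<^sub>R (\<beta> s - (\<beta> 0 + (s - 0) *\<^sub>R v))) = norm ((1/s) *\<^sub>R (\<beta> s - \<gamma> t0) - v)"
        if "s \<noteq> 0" for s
      proof -
        have "(1/s) *\<^sub>R (\<beta> s - \<gamma> t0) - v = (1/s) *\<^sub>R (\<beta> s - (\<gamma> t0 + s *\<^sub>R v))"
          using that by (simp add: scaleR_diff_right scaleR_add_right)
        then show ?thesis using \<beta>(2) by simp
      qed
      then show ?thesis by (simp add: eventually_at_filter)
    qed
    ultimately have "((\<lambda>s. norm ((1/s) *\<^sub>R (\<beta> s - \<gamma> t0) - v)) \<longlongrightarrow> 0) (at 0)"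
      by (rule Lim_transform_eventually)
    then show ?thesis by (rule LIM_zero_cancel[OF tendsto_norm_zero_cancel])
  qed
  have cont: "isCont \<beta> 0" using \<beta>(1) has_vector_derivative_continuous by blast
  have small: "\<bar>v \<bullet> n\<bar> \<le> k * norm v" if k: "0 < k" for k
  proof -
    obtain \<delta> where \<delta>: "0 < \<delta>" "\<And>q. q \<in> range \<gamma> \<Longrightarrow> dist q (\<gamma> t0) < \<delta> \<Longrightarrow> \<bar>(q - \<gamma> t0) \<bullet> n\<bar> \<le> k * norm (q - \<gamma> t0)"
      using normal_component_small[of t0 n k] dn k unfolding d_def by blast
    have "\<forall>\<^sub>F s in at 0. dist (\<beta> s) (\<gamma> t0) < \<delta>"
      using cont \<delta>(1) \<beta>(2) unfolding isCont_def tendsto_iff by simp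
    moreover have "\<forall>\<^sub>F s in at 0. \<bar>s\<bar> < e"
      unfolding eventually_at using e(1) by (intro exI[of _ e]) (auto simp: dist_real_def)
    moreover have "\<forall>\<^sub>F s in at (0::real). s \<noteq> 0" by (simp add: eventually_at_filter)
    ultimately have "\<forall>\<^sub>F s in at 0. \<bar>((1/s) *\<^sub>R (\<beta> s - \<gamma> t0)) \<bullet> n\<bar> \<le> k * norm ((1/s) *\<^sub>R (\<beta> s - \<gamma> t0))"
    proof eventually_elim
      case (elim s)
      then have "\<bar>(\<beta> s - \<gamma> t0) \<bullet> n\<bar> \<le> k * norm (\<beta> s - \<gamma> t0)" using \<delta>(2) e(2) by blast
      then have "\<bar>1/s\<bar> * \<bar>(\<beta> s - \<gamma> t0) \<bullet> n\<bar> \<le> \<bar>1/s\<bar> * (k * norm (\<beta> s - \<gamma> t0))"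
        by (intro mult_left_mono) auto
      then show ?case by (simp add: abs_mult)
    qed
    then show ?thesis
      by (rule tendsto_le[OF trivial_limit_at _ _, rotated 2]) (intro tendsto_intros lim)+
  qed
  have vn: "v \<bullet> n = 0"
  proof (rule ccontr)
    assume "v \<bullet> n \<noteq> 0"
    define k where "k = \<bar>v \<bullet> n\<bar> / (2 * (norm v + 1))"
    have nv: "0 < norm v + 1" by (simp add: add_nonneg_pos)
    have k: "0 < k" using \<open>v \<bullet> n \<noteq> 0\<close> nv by (simp add: k_def)
    have "\<bar>v \<bullet> n\<bar> \<le> k * (norm v + 1)" using small[OF k] k by (simp add: algebra_simps)
    also have "\<dots> = \<bar>v \<bullet> n\<bar> / 2" using nv by (simp add: k_def field_simps)
    finally show False using \<open>v \<bullet> n \<noteq> 0\<close> by simp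
  qed
  have dd: "(d$1)\<^sup>2 + (d$2)\<^sup>2 \<noteq> 0"
  proof
    assume "(d$1)\<^sup>2 + (d$2)\<^sup>2 = 0"
    then have "d = 0" by (simp add: vec_eq_iff forall_2 sum_power2_eq_zero_iff)
    then show False using derivative_nonzero by (simp add: d_def)
  qed
  have vn': "v$2 * d$1 = v$1 * d$2" using vn by (simp add: n_def inner_vec_def sum_2)
  have "v = ((v$1 * d$1 + v$2 * d$2) / ((d$1)\<^sup>2 + (d$2)\<^sup>2)) *\<^sub>R d"
  proof -
    have "v$1 * ((d$1)\<^sup>2 + (d$2)\<^sup>2) = (v$1 * d$1 + v$2 * d$2) * d$1"
      "v$2 * ((d$1)\<^sup>2 + (d$2)\<^sup>2) = (v$1 * d$1 + v$2 * d$2) * d$2"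
      using vn' by algebra+
    then show ?thesis using dd by (simp add: vec_eq_iff forall_2 nonzero_eq_divide_eq)
  qed
  then show ?thesis unfolding d_def by blast
qed

text \<open>Near \<open>\<gamma> t0\<close> a point of the curve is determined by its coordinate
  \<open>h\<close> along the tangent, and by the intermediate value theorem \<open>\<beta>\<close>
  attains every small value of this coordinate.\<close>

lemma curve_covers_neighbourhood:
  fixes \<beta> :: "real \<Rightarrow> real^2"
  assumes \<beta>: "(\<beta> has_vector_derivative v) (at 0)" "v \<noteq> 0"
    and e: "0 < e" "\<And>s. \<bar>s\<bar> < e \<Longrightarrow> \<beta> s \<in> range \<gamma>" and cont: "continuous_on {-e<..<e} \<beta>"
  shows "\<exists>\<delta>>0. range \<gamma> \<inter> ball (\<beta> 0) \<delta> \<subseteq> \<beta> ` {-e<..<e}"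
proof -
  obtain t0 where t0: "\<beta> 0 = \<gamma> t0" using e(2)[of 0] e(1) by auto
  define d where "d = vector_derivative \<gamma> (at t0)"
  obtain c where c: "v = c *\<^sub>R d" using velocity_parallel[OF \<beta>(1) t0 e] unfolding d_def by blast
  then have c0: "c \<noteq> 0" "d \<noteq> 0" using \<beta>(2) by auto
  have "continuous_on UNIV (\<lambda>t. vector_derivative \<gamma> (at t) \<bullet> d)"
    by (intro continuous_intros continuous_derivative)
  then have "isCont (\<lambda>t. vector_derivative \<gamma> (at t) \<bullet> d) t0" by (simp add: continuous_on_eq_continuous_at)
  then have "\<forall>\<^sub>F t in at t0. 0 < vector_derivative \<gamma> (at t) \<bullet> d"
    using c0 unfolding isCont_def by (intro order_tendstoD(1)[where y = "d \<bullet> d"]) (auto simp: d_def)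
  moreover have "0 < vector_derivative \<gamma> (at t0) \<bullet> d" using c0 by (simp add: d_def)
  ultimately have "\<forall>\<^sub>F t in nhds t0. 0 < vector_derivative \<gamma> (at t) \<bullet> d"
    by (simp add: eventually_nhds_conv_at)
  then obtain \<eta> where \<eta>: "0 < \<eta>" "\<And>t. dist t t0 < \<eta> \<Longrightarrow> 0 < vector_derivative \<gamma> (at t) \<bullet> d"
    unfolding eventually_nhds_metric by blast
  define h where "h q = (q - \<gamma> t0) \<bullet> d" for q
  have hinj: "s = t" if "\<bar>s - t0\<bar> < \<eta>" "\<bar>t - t0\<bar> < \<eta>" "h (\<gamma> s) = h (\<gamma> t)" for s t
  proof -
    have mono: "h (\<gamma> s) < h (\<gamma> t)" if "s < t" "\<bar>s - t0\<bar> < \<eta>" "\<bar>t - t0\<bar> < \<eta>" for s t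
    proof (rule DERIV_pos_imp_increasing[OF that(1)])
      fix r assume r: "s \<le> r" "r \<le> t"
      have "((\<lambda>r. h (\<gamma> r)) has_real_derivative (vector_derivative \<gamma> (at r) \<bullet> d)) (at r)"
        unfolding h_def has_real_derivative_iff_has_vector_derivative
        using bounded_linear.has_vector_derivative[OF bounded_linear_inner_left, of "\<lambda>r. \<gamma> r - \<gamma> t0"]
          has_vector_derivative_diff[OF derivative[of r] has_vector_derivative_const[of "\<gamma> t0"]] by simp
      moreover have "0 < vector_derivative \<gamma> (at r) \<bullet> d" using \<eta>(2)[of r] r that by (auto simp: dist_real_def)
      ultimately show "\<exists>y. ((\<lambda>r. h (\<gamma> r)) has_real_derivative y) (at r) \<and> 0 < y" by blast
    qed
    show ?thesis using mono[of s t] mono[of t s] that by (cases s t rule: linorder_cases) auto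
  qed
  obtain \<delta>0 where \<delta>0: "0 < \<delta>0" "\<And>q. q \<in> range \<gamma> \<Longrightarrow> dist q (\<gamma> t0) < \<delta>0 \<Longrightarrow> (\<exists>t. \<bar>t - t0\<bar> < \<eta> \<and> q = \<gamma> t)"
    using local_parameter[OF \<eta>(1)] by blast
  have hinj': "q = q'" if "q \<in> range \<gamma>" "q' \<in> range \<gamma>" "dist q (\<gamma> t0) < \<delta>0" "dist q' (\<gamma> t0) < \<delta>0" "h q = h q'" for q q'
    using \<delta>0(2)[OF that(1,3)] \<delta>0(2)[OF that(2,4)] hinj that(5) by blast
  have "isCont \<beta> 0" using \<beta>(1) has_vector_derivative_continuous by blast
  then obtain e' where e': "0 < e'" "\<And>s. \<bar>s\<bar> < e' \<Longrightarrow> dist (\<beta> s) (\<gamma> t0) < \<delta>0"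
    using \<delta>0(1) t0 unfolding continuous_at_eps_delta by (auto simp: dist_real_def)
  define \<epsilon> where "\<epsilon> = min e e'"
  have \<epsilon>: "0 < \<epsilon>" using e e' by (simp add: \<epsilon>_def)
  \<comment> \<open>The factor \<open>c\<close> makes the derivative at 0 positive whichever way
    \<open>\<beta>\<close> runs along the curve.\<close>
  have hD: "((\<lambda>s. c * h (\<beta> s)) has_real_derivative (c * (v \<bullet> d))) (at 0)"
    unfolding h_def has_real_derivative_iff_has_vector_derivative
    using bounded_linear.has_vector_derivative[OF bounded_linear_inner_left, of "\<lambda>r. \<beta> r - \<gamma> t0"]
      has_vector_derivative_diff[OF \<beta>(1) has_vector_derivative_const[of "\<gamma> t0"]]
    by (intro has_vector_derivative_mult_right) simp
  have cpos: "0 < c * (v \<bullet> d)" using c0 c by (simp flip: mult.assoc power2_eq_square)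
  have h0: "h (\<beta> 0) = 0" by (simp add: h_def t0)
  obtain r1 where r1: "0 < r1" "\<And>k. 0 < k \<Longrightarrow> k < r1 \<Longrightarrow> 0 < c * h (\<beta> k)"
    using DERIV_pos_inc_right[OF hD cpos] h0 by auto
  obtain r2 where r2: "0 < r2" "\<And>k. 0 < k \<Longrightarrow> k < r2 \<Longrightarrow> c * h (\<beta> (- k)) < 0"
    using DERIV_pos_inc_left[OF hD cpos] h0 by auto
  define s where "s = min \<epsilon> (min r1 r2) / 2"
  have s: "0 < s" "s < \<epsilon>" "s < r1" "s < r2" using \<epsilon> r1 r2 by (auto simp: s_def)
  \<comment> \<open>Any value of \<open>c * h\<close> smaller than \<open>m\<close> in modulus lies
    between those at \<open>- s\<close> and \<open>s\<close>; the second entry of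
    \<open>\<delta>\<close> ensures this for points near \<open>\<gamma> t0\<close>.\<close>
  define m where "m = min (c * h (\<beta> s)) (- (c * h (\<beta> (- s))))"
  have m: "0 < m" using r1(2)[of s] r2(2)[of s] s by (simp add: m_def)
  define \<delta> where "\<delta> = min \<delta>0 (m / (\<bar>c\<bar> * norm d))"
  have cd: "0 < \<bar>c\<bar> * norm d" using c0 by simp
  have \<delta>: "0 < \<delta>" using \<delta>0 m cd by (simp add: \<delta>_def)
  have "q \<in> \<beta> ` {-e<..<e}" if q: "q \<in> range \<gamma>" "dist q (\<gamma> t0) < \<delta>" for q
  proof -
    have "\<bar>c * h q\<bar> \<le> \<bar>c\<bar> * (norm (q - \<gamma> t0) * norm d)"
      unfolding abs_mult h_def by (intro mult_left_mono Cauchy_Schwarz_ineq2) auto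
    also have "\<dots> = norm (q - \<gamma> t0) * (\<bar>c\<bar> * norm d)" by simp
    also have "\<dots> < m" using q(2) cd by (simp add: \<delta>_def dist_norm pos_less_divide_eq)
    finally have "c * h (\<beta> (- s)) \<le> c * h q" "c * h q \<le> c * h (\<beta> s)" by (auto simp: m_def)
    moreover have "continuous_on {-s..s} (\<lambda>s. c * h (\<beta> s))"
      unfolding h_def
      by (intro continuous_intros continuous_on_subset[OF cont]) (use s in \<open>auto simp: \<epsilon>_def\<close>)
    ultimately obtain k where k: "- s \<le> k" "k \<le> s" "c * h (\<beta> k) = c * h q"
      using IVT'[of "\<lambda>s. c * h (\<beta> s)" "- s" "c * h q" s] s by auto
    have ke: "\<bar>k\<bar> < e" "\<bar>k\<bar> < e'" using k s by (auto simp: \<epsilon>_def)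
    have "q = \<beta> k"
      by (rule hinj') (use q k c0 ke e(2)[of k] e'(2)[of k] in \<open>auto simp: \<delta>_def\<close>)
    moreover have "k \<in> {-e<..<e}" using ke by auto
    ultimately show ?thesis by blast
  qed
  then show ?thesis using \<delta> t0 by (intro exI[of _ \<delta>]) (auto simp: dist_commute)
qed

end

section \<open>Compact minimal surfaces with boundary\<close>

text \<open>\<open>param\<close> relates a chart to all admissible smooth extensions of
  \<open>\<phi>\<close> in it. It is a relation because an extension across the edge is not
  unique.\<close>

locale minimal_surface =
  fixes S :: "'a topology" and \<phi> :: "'a \<Rightarrow> real^3"
    and param :: "'a set \<Rightarrow> ('a \<Rightarrow> real \<times> real) \<Rightarrow> (real \<times> real) set \<Rightarrow> (real \<times> real \<Rightarrow> real^3) \<Rightarrow> bool"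
  assumes compact: "compact_space S"
    and chart: "\<And>U \<psi> W F. param U \<psi> W F \<Longrightarrow> surface_chart S U \<psi>"
    and rep: "\<And>U \<psi> W F. param U \<psi> W F \<Longrightarrow> local_rep \<phi> U \<psi> W F"
    and imm: "\<And>U \<psi> W F x. param U \<psi> W F \<Longrightarrow> x \<in> U \<Longrightarrow> inj (frechet_derivative F (at (\<psi> x)))"
    and minimal: "\<And>U \<psi> W F x. param U \<psi> W F \<Longrightarrow> x \<in> U \<Longrightarrow> mean_curvature F (\<psi> x) = 0"
    and cover: "\<And>x. x \<in> topspace S \<Longrightarrow> \<exists>U \<psi> W F. param U \<psi> W F \<and> x \<in> U"
begin

text \<open>One chart serves as witness; \<open>boundary_chart\<close> shows that all charts
  agree.\<close>

definition boundary :: "'a set" where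
  "boundary = {x. \<exists>U \<psi> W F. param U \<psi> W F \<and> x \<in> U \<and> snd (\<psi> x) = 0}"

lemma paramD:
  assumes "param U \<psi> W F"
  shows "open W" "smooth_on W F" "x \<in> U \<Longrightarrow> \<psi> x \<in> W" "x \<in> U \<Longrightarrow> F (\<psi> x) = \<phi> x"
    "x \<in> U \<Longrightarrow> F differentiable (at (\<psi> x))" "x \<in> U \<Longrightarrow> x \<in> topspace S" "x \<in> U \<Longrightarrow> 0 \<le> snd (\<psi> x)"
proof -
  note r = rep[OF assms, unfolded local_rep_def]
  show "open W" "smooth_on W F" "x \<in> U \<Longrightarrow> \<psi> x \<in> W" "x \<in> U \<Longrightarrow> F (\<psi> x) = \<phi> x" using r by auto
  show "x \<in> U \<Longrightarrow> F differentiable (at (\<psi> x))" using r smooth_on_differentiable by blast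
  show "x \<in> U \<Longrightarrow> x \<in> topspace S" using openin_subset[OF surface_chart_open[OF chart[OF assms]]] by blast
  show "x \<in> U \<Longrightarrow> 0 \<le> snd (\<psi> x)"
    using surface_chart_upper_half[OF chart[OF assms]] by (auto simp: upper_half_def)
qed

lemma continuous_\<phi>: "continuous_map S euclidean \<phi>"
  unfolding continuous_map_def
proof (intro conjI allI impI)
  fix V :: "(real^3) set" assume "openin euclidean V"
  then have V: "open V" by simp
  show "openin S {x \<in> topspace S. \<phi> x \<in> V}"
  proof (subst openin_subopen, intro ballI)
    fix x assume x: "x \<in> {x \<in> topspace S. \<phi> x \<in> V}"
    then obtain U \<psi> W F where p: "param U \<psi> W F" "x \<in> U" using cover by blast
    note pd = paramD[OF p(1)]
    let ?N = "{y \<in> U. \<psi> y \<in> W \<inter> F -` V}"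
    have "open (W \<inter> F -` V)"
      using continuous_open_preimage[OF smooth_on_continuous[OF pd(2)] pd(1) V] .
    then have "openin S ?N" by (rule surface_chart_preimage_open[OF chart[OF p(1)]])
    moreover have "x \<in> ?N" using p(2) x pd by auto
    moreover have "?N \<subseteq> {x \<in> topspace S. \<phi> x \<in> V}" using pd by auto
    ultimately show "\<exists>T. openin S T \<and> x \<in> T \<and> T \<subseteq> {x \<in> topspace S. \<phi> x \<in> V}" by blast
  qed
qed auto

lemma boundary_subset: "boundary \<subseteq> topspace S"
  using paramD(6) by (auto simp: boundary_def)

text \<open>Both \<open>w\<close> and \<open>- w\<close> are directions along which the half-plane
  is not left, so both images have nonnegative second component; as the images add up to 0, these
  components vanish.\<close>

lemma transition_boundary_vector:
  assumes p1: "param U1 \<psi>1 W1 F1" "x \<in> U1" and p2: "param U2 \<psi>2 W2 F2" "x \<in> U2"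
    and s0: "snd (\<psi>2 x) = 0" and s1: "snd (\<psi>1 x) = 0 \<Longrightarrow> snd w = 0"
  shows "\<exists>a. frechet_derivative F1 (at (\<psi>1 x)) w = a *\<^sub>R pu F2 (\<psi>2 x)"
proof -
  let ?T1 = "frechet_derivative F1 (at (\<psi>1 x))" and ?T2 = "frechet_derivative F2 (at (\<psi>2 x))"
  have half: "\<exists>w'. ?T1 v = ?T2 w' \<and> 0 \<le> snd w'" if v: "snd (\<psi>1 x) = 0 \<Longrightarrow> snd v = 0" for v
  proof -
    have "\<exists>e>0. \<forall>t. 0 \<le> t \<and> t < e \<longrightarrow> \<psi>1 x + t *\<^sub>R v \<in> upper_half"
    proof (cases "snd (\<psi>1 x) = 0")
      case True
      then show ?thesis using v by (intro exI[of _ 1]) (auto simp: upper_half_def)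
    next
      case False
      then have pos: "0 < snd (\<psi>1 x)" using paramD(7)[OF p1] by simp
      define e where "e = snd (\<psi>1 x) / (\<bar>snd v\<bar> + 1)"
      have "0 \<le> snd (\<psi>1 x) + t * snd v" if "0 \<le> t" "t < e" for t
      proof -
        have "t * (\<bar>snd v\<bar> + 1) \<le> snd (\<psi>1 x)"
          using that pos_less_divide_eq[of "\<bar>snd v\<bar> + 1" t "snd (\<psi>1 x)"] by (simp add: e_def)
        moreover have "t * (- snd v) \<le> t * (\<bar>snd v\<bar> + 1)" using that by (intro mult_left_mono) auto
        ultimately show ?thesis by simp
      qed
      then show ?thesis using pos by (intro exI[of _ e]) (auto simp: e_def upper_half_def)
    qed
    then obtain e where "0 < e" "\<And>t. 0 \<le> t \<Longrightarrow> t < e \<Longrightarrow> \<psi>1 x + t *\<^sub>R v \<in> upper_half" by blast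
    from transition_vector[OF chart[OF p1(1)] chart[OF p2(1)] rep[OF p1(1)] rep[OF p2(1)] p1(2) p2(2) imm[OF p2] this]
    show ?thesis using s0 by blast
  qed
  obtain w1 where w1: "?T1 w = ?T2 w1" "0 \<le> snd w1" using half s1 by blast
  obtain w2 where w2: "?T1 (- w) = ?T2 w2" "0 \<le> snd w2" using half[of "- w"] s1 by auto
  have lin1: "linear ?T1" and lin2: "linear ?T2"
    using linear_frechet_derivative paramD(5) p1 p2 by blast+
  have "?T2 (w1 + w2) = ?T1 w + ?T1 (- w)" by (simp only: linear_add[OF lin2] w1(1) w2(1))
  also have "\<dots> = ?T2 0" by (simp add: linear_neg[OF lin1] linear_0[OF lin2])
  finally have "w1 + w2 = 0" using imm[OF p2] by (meson injD)
  then have "snd w1 = 0" using w1(2) w2(2) by (auto simp: add_eq_0_iff)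
  then have "?T1 w = fst w1 *\<^sub>R pu F2 (\<psi>2 x)"
    using w1(1) frechet_derivative_partials[OF paramD(5)[OF p2], of w1] by simp
  then show ?thesis by blast
qed

text \<open>At an interior point of a chart all directions are admissible, so both partial
  derivatives would be multiples of the single edge tangent of the other chart, which an immersion
  forbids.\<close>

lemma boundary_chart:
  assumes p: "param U \<psi> W F" "x \<in> U" and x: "x \<in> boundary"
  shows "snd (\<psi> x) = 0"
proof (rule ccontr)
  assume ne: "snd (\<psi> x) \<noteq> 0"
  obtain U2 \<psi>2 W2 F2 where p2: "param U2 \<psi>2 W2 F2" "x \<in> U2" "snd (\<psi>2 x) = 0"
    using x by (auto simp: boundary_def)
  obtain a b where "pu F (\<psi> x) = a *\<^sub>R pu F2 (\<psi>2 x)" "pv F (\<psi> x) = b *\<^sub>R pu F2 (\<psi>2 x)"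
    using transition_boundary_vector[OF p p2] ne unfolding pu_def pv_def by meson
  then have "cross3 (pu F (\<psi> x)) (pv F (\<psi> x)) = 0"
    by (simp add: cross_mult_left cross_mult_right)
  then show False using immersion_cross_nonzero[OF paramD(5)[OF p] imm[OF p]] by simp
qed

lemma closedin_boundary: "closedin S boundary"
  unfolding closedin_def
proof (intro conjI boundary_subset)
  show "openin S (topspace S - boundary)"
  proof (subst openin_subopen, intro ballI)
    fix x assume x: "x \<in> topspace S - boundary"
    then obtain U \<psi> W F where p: "param U \<psi> W F" "x \<in> U" using cover by blast
    let ?N = "{y \<in> U. \<psi> y \<in> {p. 0 < snd p}}"
    have "open {p :: real \<times> real. 0 < snd p}"
      by (intro open_Collect_less continuous_intros)
    then have "openin S ?N" by (rule surface_chart_preimage_open[OF chart[OF p(1)]])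
    moreover have "snd (\<psi> x) \<noteq> 0" using x p by (auto simp: boundary_def)
    then have "x \<in> ?N" using p paramD(7)[OF p] by simp
    moreover have "?N \<subseteq> topspace S - boundary"
      using boundary_chart[OF p(1)] paramD(6)[OF p(1)] by force
    ultimately show "\<exists>T. openin S T \<and> x \<in> T \<and> T \<subseteq> topspace S - boundary" by blast
  qed
qed

text \<open>A positive multiple of the inward conormal at boundary points of a half-plane chart.\<close>

definition conormal :: "(real \<times> real \<Rightarrow> real^3) \<Rightarrow> real \<times> real \<Rightarrow> real^3" where
  "conormal F p = (pu F p \<bullet> pu F p) *\<^sub>R pv F p - (pu F p \<bullet> pv F p) *\<^sub>R pu F p"

text \<open>Both vectors are tangent to the surface and orthogonal to the common edge direction,
  hence proportional. The chart vector \<open>w\<close> that represents the first one points into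
  the half-plane, and a transition preserves this, so the factor is positive.\<close>

lemma conormal_chart_independent:
  assumes p1: "param U1 \<psi>1 W1 F1" "x \<in> U1" and p2: "param U2 \<psi>2 W2 F2" "x \<in> U2"
    and x: "x \<in> boundary"
  shows "\<exists>c>0. conormal F1 (\<psi>1 x) = c *\<^sub>R conormal F2 (\<psi>2 x)"
proof -
  let ?T1 = "frechet_derivative F1 (at (\<psi>1 x))" and ?T2 = "frechet_derivative F2 (at (\<psi>2 x))"
  let ?d1 = "conormal F1 (\<psi>1 x)" and ?d2 = "conormal F2 (\<psi>2 x)"
  note s = boundary_chart[OF p1 x] boundary_chart[OF p2 x]
  note fd1 = frechet_derivative_partials[OF paramD(5)[OF p1]]
  note fd2 = frechet_derivative_partials[OF paramD(5)[OF p2]]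
  note nz1 = immersion_cross_nonzero[OF paramD(5)[OF p1] imm[OF p1]]
  note nz2 = immersion_cross_nonzero[OF paramD(5)[OF p2] imm[OF p2]]
  obtain a where a: "pu F1 (\<psi>1 x) = a *\<^sub>R pu F2 (\<psi>2 x)"
    using transition_boundary_vector[OF p1 p2 s(2), of "(1, 0)"] unfolding pu_def by auto
  have a0: "a \<noteq> 0" using a nz1 by auto
  define E1 where "E1 = pu F1 (\<psi>1 x) \<bullet> pu F1 (\<psi>1 x)"
  define E2 where "E2 = pu F2 (\<psi>2 x) \<bullet> pu F2 (\<psi>2 x)"
  have E: "0 < E1" "0 < E2" using nz1 nz2 by (auto simp: E1_def E2_def)
  define w where "w = (- (pu F1 (\<psi>1 x) \<bullet> pv F1 (\<psi>1 x)), E1)"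
  have d1: "?T1 w = ?d1" by (simp add: fd1 w_def conormal_def E1_def)
  have "\<psi>1 x + t *\<^sub>R w \<in> upper_half" if "0 \<le> t" for t
    using that E s by (simp add: upper_half_def w_def)
  then obtain w' where w': "?T1 w = ?T2 w'" "0 \<le> snd w'"
    using transition_vector[OF chart[OF p1(1)] chart[OF p2(1)] rep[OF p1(1)] rep[OF p2(1)] p1(2) p2(2) imm[OF p2],
        of 1 w] s by (metis zero_less_one)
  have d1': "?d1 = fst w' *\<^sub>R pu F2 (\<psi>2 x) + snd w' *\<^sub>R pv F2 (\<psi>2 x)" using w' d1 fd2 by simp
  have "?d1 \<bullet> pu F1 (\<psi>1 x) = 0" 
    by (simp add: conormal_def inner_diff_left inner_commute[of "pv F1 (\<psi>1 x)"] mult.commute)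
  then have "?d1 \<bullet> pu F2 (\<psi>2 x) = 0" using a a0 by simp
  then have f: "fst w' * E2 = - snd w' * (pu F2 (\<psi>2 x) \<bullet> pv F2 (\<psi>2 x))"
    unfolding d1' by (simp add: inner_add_left inner_commute[of "pv F2 (\<psi>2 x)"] E2_def add_eq_0_iff2)
  have "E2 *\<^sub>R ?d1 = (fst w' * E2) *\<^sub>R pu F2 (\<psi>2 x) + (snd w' * E2) *\<^sub>R pv F2 (\<psi>2 x)"
    unfolding d1' by (simp add: scaleR_add_right mult.commute)
  also have "\<dots> = snd w' *\<^sub>R ?d2"
    unfolding f by (simp add: conormal_def E2_def scaleR_diff_right)
  finally have main: "E2 *\<^sub>R ?d1 = snd w' *\<^sub>R ?d2" .
  have "?d1 \<noteq> 0"
  proof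
    assume "?d1 = 0"
    then have "?T1 w = ?T1 0" using d1 fd1[of 0] by simp
    then have "w = 0" using imm[OF p1] by (meson injD)
    then show False using E by (simp add: w_def zero_prod_def)
  qed
  then have "snd w' \<noteq> 0" using main E by auto
  then have "0 < snd w' / E2" using w'(2) E by simp
  moreover have "?d1 = (snd w' / E2) *\<^sub>R ?d2"
  proof -
    have "?d1 = inverse E2 *\<^sub>R (E2 *\<^sub>R ?d1)" using E by simp
    then show ?thesis unfolding main by (simp add: divide_inverse mult.commute)
  qed
  ultimately show ?thesis by blast
qed

section \<open>The maximum principle on the whole surface\<close>

text \<open>Local constancy is required because a level set at a maximum need not be open: at a
  boundary maximum of Hopf type the nearby interior values are smaller.\<close>

definition contact :: "real^3 \<Rightarrow> real \<Rightarrow> 'a set \<Rightarrow> 'a set" where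
  "contact k M X = {x \<in> X. \<exists>N. openin S N \<and> x \<in> N \<and> (\<forall>y\<in>N. k \<bullet> \<phi> y = M)}"

lemma contact_value: "x \<in> contact k M X \<Longrightarrow> k \<bullet> \<phi> x = M"
  by (auto simp: contact_def)

text \<open>\<open>half_ball_dichotomy\<close> read in a chart. In the Hopf case a contact point
  close to \<open>x\<close> is impossible, as the value \<open>M\<close> would spread from it to
  interior points of the half disc.\<close>

lemma contact_alternative:
  assumes X: "openin S X" "x \<in> X" and le: "\<And>y. y \<in> X \<Longrightarrow> k \<bullet> \<phi> y \<le> M" and eq: "k \<bullet> \<phi> x = M"
    and p: "param U \<psi> W F" "x \<in> U"
  shows "x \<in> contact k M X \<or> (snd (\<psi> x) = 0 \<and> k \<bullet> pu F (\<psi> x) = 0 \<and> k \<bullet> pv F (\<psi> x) < 0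
    \<and> (\<exists>N. openin S N \<and> x \<in> N \<and> N \<inter> contact k M X = {}))"
proof -
  note pd = paramD[OF p(1)]
  note ch = chart[OF p(1)]
  obtain r where r: "0 < r" "ball (\<psi> x) r \<inter> upper_half \<subseteq> \<psi> ` (U \<inter> X)"
    using surface_chart_image_ball[OF ch X(1) p(2) X(2)] .
  define N where "N = {y \<in> U. \<psi> y \<in> ball (\<psi> x) r}"
  have N: "openin S N" "x \<in> N"
    unfolding N_def using surface_chart_preimage_open[OF ch open_ball] p(2) r(1) by auto
  have D: "\<exists>y \<in> U \<inter> X. q = \<psi> y" if "q \<in> ball (\<psi> x) r \<inter> upper_half" for q using r(2) that by blast
  have W: "ball (\<psi> x) r \<inter> upper_half \<subseteq> W" using D pd(3) by blast
  have "(\<forall>q \<in> ball (\<psi> x) r \<inter> upper_half. k \<bullet> F q = M) \<or>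
    (snd (\<psi> x) = 0 \<and> k \<bullet> pu F (\<psi> x) = 0 \<and> k \<bullet> pv F (\<psi> x) < 0 \<and> (\<forall>q \<in> ball (\<psi> x) r. 0 < snd q \<longrightarrow> k \<bullet> F q < M))"
  proof (rule half_ball_dichotomy[OF pd(1,2) W r(1) pd(7)[OF p(2)]])
    fix q assume "q \<in> ball (\<psi> x) r \<inter> upper_half"
    then obtain y where y: "y \<in> U" "y \<in> X" "q = \<psi> y" using D by blast
    show "inj (frechet_derivative F (at q))" "mean_curvature F q = 0" "k \<bullet> F q \<le> M"
      using y imm[OF p(1)] minimal[OF p(1)] le pd(4) by auto
  next
    show "k \<bullet> F (\<psi> x) = M" using eq pd(4) p(2) by simp
  qed
  then show ?thesis
  proof
    assume all: "\<forall>q \<in> ball (\<psi> x) r \<inter> upper_half. k \<bullet> F q = M"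
    have "k \<bullet> \<phi> y = M" if "y \<in> N" for y
    proof -
      have "y \<in> U" "\<psi> y \<in> ball (\<psi> x) r \<inter> upper_half"
        using surface_chart_upper_half[OF ch, of y] that by (auto simp: N_def)
      then show ?thesis using all pd(4)[of y] by metis
    qed
    then show ?thesis using N X(2) by (auto simp: contact_def)
  next
    assume A: "snd (\<psi> x) = 0 \<and> k \<bullet> pu F (\<psi> x) = 0 \<and> k \<bullet> pv F (\<psi> x) < 0 \<and> (\<forall>q \<in> ball (\<psi> x) r. 0 < snd q \<longrightarrow> k \<bullet> F q < M)"
    have False if y: "y \<in> N" "y \<in> contact k M X" for y
    proof -
      obtain N' where N': "openin S N'" "y \<in> N'" "\<And>z. z \<in> N' \<Longrightarrow> k \<bullet> \<phi> z = M"
        using y(2) by (auto simp: contact_def)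
      have yU: "y \<in> U" "dist (\<psi> x) (\<psi> y) < r" using y(1) by (auto simp: N_def)
      obtain r' where r': "0 < r'" "ball (\<psi> y) r' \<inter> upper_half \<subseteq> \<psi> ` (U \<inter> N')"
        using surface_chart_image_ball[OF ch N'(1) yU(1) N'(2)] .
      \<comment> \<open>A step straight up from \<open>\<psi> y\<close> leaves the edge while
        staying in both discs.\<close>
      define t where "t = min r' (r - dist (\<psi> x) (\<psi> y)) / 2"
      have t: "0 < t" "t < r'" "t < r - dist (\<psi> x) (\<psi> y)" using r' yU by (auto simp: t_def)
      define q where "q = \<psi> y + (0, t)"
      have dq: "dist (\<psi> y) q = t" using t by (simp add: q_def dist_norm)
      have sq: "0 < snd q" using pd(7)[OF yU(1)] t by (simp add: q_def)
      have "q \<in> ball (\<psi> y) r' \<inter> upper_half" using dq t sq by (simp add: upper_half_def)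
      then obtain z where "z \<in> U" "z \<in> N'" "q = \<psi> z" using r'(2) by blast
      then have "k \<bullet> F q = M" using N'(3) pd(4) by simp
      moreover have "q \<in> ball (\<psi> x) r" using dist_triangle[of "\<psi> x" q "\<psi> y"] dq t by simp
      ultimately show False using A sq by force
    qed
    then show ?thesis using A N by blast
  qed
qed

text \<open>Closedness is the substance: next to a point with value \<open>M\<close> that is not a
  contact point, \<open>contact_alternative\<close> excludes contact points; elsewhere continuity or
  the closedness of \<open>X\<close> does.\<close>

lemma contact_clopen:
  assumes X: "openin S X" "closedin S X" and le: "\<And>y. y \<in> X \<Longrightarrow> k \<bullet> \<phi> y \<le> M"
  shows "openin S (contact k M X)" "closedin S (contact k M X)"
proof -
  show "openin S (contact k M X)"
  proof (subst openin_subopen, intro ballI)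
    fix x assume "x \<in> contact k M X"
    then obtain N where N: "openin S N" "x \<in> N" "\<forall>y\<in>N. k \<bullet> \<phi> y = M" "x \<in> X" by (auto simp: contact_def)
    have "N \<inter> X \<subseteq> contact k M X" using N by (auto simp: contact_def)
    then show "\<exists>T. openin S T \<and> x \<in> T \<and> T \<subseteq> contact k M X"
      using N X(1) by (intro exI[of _ "N \<inter> X"]) auto
  qed
  have sub: "contact k M X \<subseteq> topspace S" using openin_subset[OF X(1)] by (auto simp: contact_def)
  have "openin S (topspace S - contact k M X)"
  proof (subst openin_subopen, intro ballI)
    fix x assume x: "x \<in> topspace S - contact k M X"
    show "\<exists>T. openin S T \<and> x \<in> T \<and> T \<subseteq> topspace S - contact k M X"
    proof (cases "x \<in> X \<and> k \<bullet> \<phi> x = M")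
      case True
      obtain U \<psi> W F where p: "param U \<psi> W F" "x \<in> U" using cover x by blast
      obtain N where N: "openin S N" "x \<in> N" "N \<inter> contact k M X = {}"
        using contact_alternative[OF X(1) _ le _ p] True x by blast
      then show ?thesis using openin_subset[OF N(1)] by blast
    next
      case False
      show ?thesis
      proof (cases "x \<in> X")
        case True
        have "openin S {y \<in> topspace S. \<phi> y \<in> {v. k \<bullet> v \<noteq> M}}"
          by (rule openin_continuous_map_preimage[OF continuous_\<phi>])
            (auto intro!: open_Collect_neq continuous_intros)
        then show ?thesis using x True False contact_value[of _ k M X]
          by (intro exI[of _ "{y \<in> topspace S. \<phi> y \<in> {v. k \<bullet> v \<noteq> M}}"]) auto
      next
        case False
        then show ?thesis using x X(2) by (intro exI[of _ "topspace S - X"]) (auto simp: contact_def)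
      qed
    qed
  qed
  then show "closedin S (contact k M X)" using sub by (simp add: closedin_def)
qed

lemma attains_max:
  assumes "closedin S X" "X \<noteq> {}"
  obtains x where "x \<in> X" "\<And>y. y \<in> X \<Longrightarrow> k \<bullet> \<phi> y \<le> k \<bullet> \<phi> x"
proof -
  have "compactin S X" using assms(1) compact by (simp add: closedin_compact_space)
  then have "compact (\<phi> ` X)" using image_compactin[OF _ continuous_\<phi>] by simp
  moreover have "continuous_on (\<phi> ` X) (\<lambda>v. k \<bullet> v)" by (intro continuous_intros)
  ultimately obtain v where "v \<in> \<phi> ` X" "\<And>v'. v' \<in> \<phi> ` X \<Longrightarrow> k \<bullet> v' \<le> k \<bullet> v"
    using continuous_attains_sup[of "\<phi> ` X" "\<lambda>v. k \<bullet> v"] assms(2) by blast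
  then show ?thesis using that by blast
qed

text \<open>Constancy is known on a half disc only, so the one-sided derivative test is applied to
  \<open>k\<close> and to \<open>- k\<close>.\<close>

lemma locally_constant_partials:
  assumes X: "openin S X" "x \<in> X" and const: "\<And>y. y \<in> X \<Longrightarrow> k \<bullet> \<phi> y = M"
    and p: "param U \<psi> W F" "x \<in> U"
  shows "k \<bullet> pu F (\<psi> x) = 0" "k \<bullet> pv F (\<psi> x) = 0"
proof -
  note pd = paramD[OF p(1)]
  obtain r where r: "0 < r" "ball (\<psi> x) r \<inter> upper_half \<subseteq> \<psi> ` (U \<inter> X)"
    using surface_chart_image_ball[OF chart[OF p(1)] X(1) p(2) X(2)] .
  have M: "k \<bullet> F q = M" if "q \<in> ball (\<psi> x) r \<inter> upper_half" for q
    using r(2) that const pd(4) by force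
  have zero: "k \<bullet> pu F (\<psi> x) * fst v + k \<bullet> pv F (\<psi> x) * snd v = 0" if v: "norm v = 1" "0 \<le> snd v" for v
  proof -
    have line: "((\<lambda>t. k' \<bullet> F (\<psi> x + t *\<^sub>R v)) has_real_derivative (k' \<bullet> pu F (\<psi> x) * fst v + k' \<bullet> pv F (\<psi> x) * snd v)) (at 0)" for k'
      by (rule has_real_derivative_along_line) (use smooth_has_derivative_inner[OF pd(2) pd(3)[OF p(2)]] in simp)
    have M': "k \<bullet> F (\<psi> x + t *\<^sub>R v) = M" if "0 \<le> t" "t < r" for t
      using that v pd(7)[OF p(2)] by (intro M) (auto simp: dist_norm upper_half_def)
    have c: "k \<bullet> F (\<psi> x + t *\<^sub>R v) = k \<bullet> F (\<psi> x + 0 *\<^sub>R v)" if "0 < t" "t < r" for t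
      using that M'[of t] M'[of 0] r(1) by linarith
    have "k \<bullet> pu F (\<psi> x) * fst v + k \<bullet> pv F (\<psi> x) * snd v \<le> 0"
      by (rule nonpos_derivative_of_local_max_right[OF line r(1)]) (use c in simp)
    moreover have "- k \<bullet> pu F (\<psi> x) * fst v + - k \<bullet> pv F (\<psi> x) * snd v \<le> 0"
      by (rule nonpos_derivative_of_local_max_right[OF line r(1)]) (use c in simp)
    ultimately show ?thesis by simp
  qed
  show "k \<bullet> pu F (\<psi> x) = 0" "k \<bullet> pv F (\<psi> x) = 0" using zero[of "(1,0)"] zero[of "(0,1)"] by auto
qed

text \<open>A component without boundary would be a closed minimal surface, on which two coordinates
  are constant by the maximum principle.\<close>

lemma clopen_meets_boundary:
  assumes X: "openin S X" "closedin S X" "X \<noteq> {}"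
  shows "X \<inter> boundary \<noteq> {}"
proof
  assume disj: "X \<inter> boundary = {}"
  have step: "\<exists>Z M. Z \<subseteq> Y \<and> openin S Z \<and> closedin S Z \<and> Z \<noteq> {} \<and> (\<forall>z\<in>Z. k \<bullet> \<phi> z = M)"
    if Y: "openin S Y" "closedin S Y" "Y \<noteq> {}" "Y \<subseteq> X" for Y k
  proof -
    obtain x where x: "x \<in> Y" "\<And>y. y \<in> Y \<Longrightarrow> k \<bullet> \<phi> y \<le> k \<bullet> \<phi> x" using attains_max[OF Y(2,3), of k] by blast
    have xt: "x \<in> topspace S" using x(1) openin_subset[OF Y(1)] by blast
    obtain U \<psi> W F where p: "param U \<psi> W F" "x \<in> U" using cover[OF xt] by blast
    have "snd (\<psi> x) \<noteq> 0" using p x(1) Y(4) disj unfolding boundary_def by blast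
    then have "x \<in> contact k (k \<bullet> \<phi> x) Y" using contact_alternative[OF Y(1) x refl p] by blast
    moreover have "contact k (k \<bullet> \<phi> x) Y \<subseteq> Y" by (auto simp: contact_def)
    ultimately show ?thesis using contact_clopen[OF Y(1,2) x(2)] contact_value by blast
  qed
  \<comment> \<open>The argument is repeated inside the part just found. Where two coordinates are
    constant both partial derivatives are vertical, hence parallel.\<close>
  obtain Z1 M1 where Z1: "Z1 \<subseteq> X" "openin S Z1" "closedin S Z1" "Z1 \<noteq> {}" "\<forall>z\<in>Z1. axis 1 1 \<bullet> \<phi> z = M1"
    using step[OF X order_refl, of "axis 1 1"] by blast
  obtain Z2 M2 where Z2: "Z2 \<subseteq> Z1" "openin S Z2" "closedin S Z2" "Z2 \<noteq> {}" "\<forall>z\<in>Z2. axis 2 1 \<bullet> \<phi> z = M2"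
    using step[OF Z1(2-4,1), of "axis 2 1"] by blast
  obtain x where x: "x \<in> Z2" using Z2 by blast
  have xt: "x \<in> topspace S" using x(1) openin_subset[OF Z2(2)] by blast
  obtain U \<psi> W F where p: "param U \<psi> W F" "x \<in> U" using cover[OF xt] by blast
  have c1: "\<And>y. y \<in> Z2 \<Longrightarrow> axis 1 1 \<bullet> \<phi> y = M1" and c2: "\<And>y. y \<in> Z2 \<Longrightarrow> axis 2 1 \<bullet> \<phi> y = M2"
    using Z1 Z2 by blast+
  have "pu F (\<psi> x) $ 1 = 0" "pv F (\<psi> x) $ 1 = 0" "pu F (\<psi> x) $ 2 = 0" "pv F (\<psi> x) $ 2 = 0"
    using locally_constant_partials[OF Z2(2) x c1 p] locally_constant_partials[OF Z2(2) x c2 p]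
    by (auto simp: inner_axis')
  then have "cross3 (pu F (\<psi> x)) (pv F (\<psi> x)) = 0" by (simp add: cross3_def vec_eq_iff forall_3)
  then show False using immersion_cross_nonzero[OF paramD(5)[OF p] imm[OF p]] by simp
qed

text \<open>Without contact points a maximum point already lies on the boundary; otherwise the
  contact set is a nonempty clopen part and reaches the boundary.\<close>

lemma max_attained_on_boundary:
  assumes le: "\<And>y. y \<in> topspace S \<Longrightarrow> k \<bullet> \<phi> y \<le> M" and x: "x \<in> topspace S" "k \<bullet> \<phi> x = M"
  shows "\<exists>y \<in> boundary. k \<bullet> \<phi> y = M"
proof (cases "contact k M (topspace S) = {}")
  case True
  obtain U \<psi> W F where p: "param U \<psi> W F" "x \<in> U" using cover[OF x(1)] by blast
  have "snd (\<psi> x) = 0" using contact_alternative[OF openin_topspace x(1) le x(2) p] True by blast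
  then have "x \<in> boundary" using p by (auto simp: boundary_def)
  then show ?thesis using x by blast
next
  case False
  then show ?thesis
    using clopen_meets_boundary[OF contact_clopen[OF openin_topspace closedin_topspace le]] contact_value by blast
qed

end

section \<open>Minimal surfaces in a vertical cylinder\<close>

lemma proj_nth [simp]: "proj q $ 1 = q $ 1" "proj q $ 2 = q $ 2"
  by (simp_all add: proj_def)

lemma proj_lift [simp]: "proj (lift p z) = p"
  by (simp add: lift_def vec_eq_iff forall_2)

lemma lift_nth_3 [simp]: "lift p z $ 3 = z"
  by (simp add: lift_def)

lemma bounded_linear_proj: "bounded_linear proj"
  unfolding linear_conv_bounded_linear[symmetric]
  by (rule linearI) (simp_all add: vec_eq_iff forall_2)

text \<open>\<open>boundary_graph\<close> constrains the image only, so the boundary may cover the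
  curve more than once, as for two copies of one disc. The absolute value in
  \<open>constant_angle\<close> makes the condition independent of the orientation of a
  chart.\<close>

locale cylinder_surface = minimal_surface S \<phi> param + closed_curve \<gamma>
  for S :: "'a topology" and \<phi> param \<gamma> +
  fixes f :: "real^2 \<Rightarrow> real" and c :: real
  assumes boundary_on_cylinder: "\<And>x. x \<in> boundary \<Longrightarrow> proj (\<phi> x) \<in> range \<gamma>"
    and boundary_graph: "\<phi> ` boundary = {lift p (f p) | p. p \<in> range \<gamma>}"
    and non_vertical: "\<And>U \<psi> W F x. param U \<psi> W F \<Longrightarrow> x \<in> U \<Longrightarrow> snd (\<psi> x) = 0 \<Longrightarrow> proj (pu F (\<psi> x)) \<noteq> 0"
    and constant_angle: "\<And>U \<psi> W F x. param U \<psi> W F \<Longrightarrow> x \<in> U \<Longrightarrow> snd (\<psi> x) = 0 \<Longrightarrow>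
      \<bar>unit_normal F (\<psi> x) \<bullet> cyl_normal \<gamma> (\<phi> x)\<bar> = c"
begin

lemma boundary_height: "x \<in> boundary \<Longrightarrow> \<phi> x $ 3 = f (proj (\<phi> x))"
proof -
  assume "x \<in> boundary"
  then have "\<phi> x \<in> {lift p (f p) | p. p \<in> range \<gamma>}" using boundary_graph by blast
  then obtain p where "\<phi> x = lift p (f p)" by blast
  then show ?thesis by simp
qed

text \<open>The projected edge of a chart meets the hypotheses of \<open>velocity_parallel\<close>
  and \<open>curve_covers_neighbourhood\<close>; \<open>N\<close> confines it to a chosen part of
  the boundary.\<close>

lemma boundary_curve:
  assumes N: "openin S N" "x \<in> N" and p: "param U \<psi> W F" "x \<in> U" and s0: "snd (\<psi> x) = 0"
  defines "\<beta> \<equiv> \<lambda>s. proj (F (\<psi> x + (s, 0)))"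
  obtains e where "0 < e" "\<And>s. \<bar>s\<bar> < e \<Longrightarrow> \<exists>y \<in> boundary \<inter> N. \<beta> s = proj (\<phi> y)"
    "continuous_on {-e<..<e} \<beta>" "(\<beta> has_vector_derivative proj (pu F (\<psi> x))) (at 0)" "\<beta> 0 = proj (\<phi> x)"
proof -
  note pd = paramD[OF p(1)]
  obtain r where r: "0 < r" "ball (\<psi> x) r \<inter> upper_half \<subseteq> \<psi> ` (U \<inter> N)"
    using surface_chart_image_ball[OF chart[OF p(1)] N(1) p(2) N(2)] .
  have near: "\<exists>y \<in> U \<inter> N. \<psi> x + (s, 0) = \<psi> y" if "\<bar>s\<bar> < r" for s
  proof -
    have "\<psi> x + (s, 0) \<in> ball (\<psi> x) r \<inter> upper_half"
      using that s0 by (simp add: upper_half_def dist_norm)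
    then show ?thesis using r(2) by blast
  qed
  have dline: "((\<lambda>s. \<psi> x + (s, 0)) has_vector_derivative (1, 0)) (at s)" for s
    by (rule has_vector_derivative_eq_rhs[OF has_vector_derivative_add[OF has_vector_derivative_const
          has_vector_derivative_Pair[OF has_vector_derivative_id has_vector_derivative_const]]]) simp
  have d\<beta>: "(\<beta> has_vector_derivative proj (pu F (\<psi> x + (s, 0)))) (at s)" if "\<bar>s\<bar> < r" for s
  proof -
    have W: "\<psi> x + (s, 0) \<in> W" using near[OF that] pd(3) by auto
    have "((\<lambda>s. F (\<psi> x + (s, 0))) has_vector_derivative pu F (\<psi> x + (s, 0))) (at s)"
      using vector_derivative_diff_chain_within[OF dline has_derivative_at_withinI[OF smooth_has_derivative[OF pd(2) W]]]
      by (simp add: o_def)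
    then show ?thesis unfolding \<beta>_def by (rule bounded_linear.has_vector_derivative[OF bounded_linear_proj])
  qed
  show ?thesis
  proof (rule that[OF r(1)])
    fix s :: real assume s: "\<bar>s\<bar> < r"
    then obtain y where y: "y \<in> U" "y \<in> N" "\<psi> x + (s, 0) = \<psi> y" using near by blast
    have "snd (\<psi> y) = 0" using s0 by (simp flip: y(3))
    then have "y \<in> boundary" using p(1) y(1) by (auto simp: boundary_def)
    then show "\<exists>y \<in> boundary \<inter> N. \<beta> s = proj (\<phi> y)" using y pd(4) by (auto simp: \<beta>_def)
  next
    show "continuous_on {-r<..<r} \<beta>"
    proof (rule continuous_at_imp_continuous_on, rule ballI)
      fix s assume "s \<in> {-r<..<r}"
      then have "\<bar>s\<bar> < r" by auto
      then show "isCont \<beta> s" using has_vector_derivative_continuous[OF d\<beta>] by blast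
    qed
    show "(\<beta> has_vector_derivative proj (pu F (\<psi> x))) (at 0)" using d\<beta>[of 0] r(1) by (simp flip: zero_prod_def)
    show "\<beta> 0 = proj (\<phi> x)" using pd(4)[OF p(2)] by (simp add: \<beta>_def flip: zero_prod_def)
  qed
qed

text \<open>The projection is closed by compactness and open in the curve because a non-vertical
  boundary curve covers a neighbourhood below each point; the curve is connected.\<close>

lemma clopen_boundary_part_covers:
  assumes N: "openin S N" and B: "closedin S (boundary \<inter> N)" "boundary \<inter> N \<noteq> {}"
  shows "(\<lambda>x. proj (\<phi> x)) ` (boundary \<inter> N) = range \<gamma>"
proof -
  let ?P = "(\<lambda>x. proj (\<phi> x)) ` (boundary \<inter> N)"
  have sub: "?P \<subseteq> range \<gamma>" using boundary_on_cylinder by auto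
  have "compactin S (boundary \<inter> N)" using B(1) compact by (simp add: closedin_compact_space)
  then have "compact (\<phi> ` (boundary \<inter> N))" using image_compactin[OF _ continuous_\<phi>] by simp
  then have "compact (proj ` \<phi> ` (boundary \<inter> N))"
    by (intro compact_continuous_image linear_continuous_on bounded_linear_proj)
  then have "closed ?P" by (simp add: image_image compact_imp_closed)
  then have "closedin (top_of_set (range \<gamma>)) ?P" using sub by (rule closed_subset[rotated])
  moreover have "openin (top_of_set (range \<gamma>)) ?P"
  proof (subst openin_contains_ball, intro conjI sub ballI)
    fix q assume "q \<in> ?P"
    then obtain x where x: "x \<in> boundary" "x \<in> N" "q = proj (\<phi> x)" by blast
    then obtain U \<psi> W F where p: "param U \<psi> W F" "x \<in> U" "snd (\<psi> x) = 0" by (auto simp: boundary_def)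
    define \<beta> where "\<beta> = (\<lambda>s. proj (F (\<psi> x + (s, 0))))"
    obtain e where e: "0 < e" "\<And>s. \<bar>s\<bar> < e \<Longrightarrow> \<exists>y \<in> boundary \<inter> N. \<beta> s = proj (\<phi> y)"
      "continuous_on {-e<..<e} \<beta>" "(\<beta> has_vector_derivative proj (pu F (\<psi> x))) (at 0)" "\<beta> 0 = proj (\<phi> x)"
      using boundary_curve[OF N x(2) p] unfolding \<beta>_def by blast
    have in_P: "\<beta> s \<in> ?P" if "\<bar>s\<bar> < e" for s using e(2)[OF that] by blast
    then obtain \<delta> where "0 < \<delta>" "range \<gamma> \<inter> ball (\<beta> 0) \<delta> \<subseteq> \<beta> ` {-e<..<e}"
      using curve_covers_neighbourhood[OF e(4) non_vertical[OF p] e(1) _ e(3)] sub by blast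
    moreover have "\<beta> ` {-e<..<e} \<subseteq> ?P" using in_P by (force simp: abs_less_iff)
    ultimately show "\<exists>e>0. ball q e \<inter> range \<gamma> \<subseteq> ?P"
      using x(3) e(5) by (intro exI[of _ \<delta>]) auto
  qed
  moreover have "connected (range \<gamma>)" by (intro connected_continuous_image continuous connected_UNIV)
  ultimately show ?thesis using B(2) unfolding connected_clopen by blast
qed

text \<open>The boundary tangent crossed with the vertical direction is a nonzero multiple of the
  cylinder normal.\<close>

lemma vertical_conormal_eq_0_iff:
  assumes p: "param U \<psi> W F" "x \<in> U" "snd (\<psi> x) = 0"
  shows "conormal F (\<psi> x) $ 3 = 0 \<longleftrightarrow> c = 0"
proof -
  have xb: "x \<in> boundary" using p by (auto simp: boundary_def)
  \<comment> \<open>The same choice as inside \<open>cyl_normal\<close>, so that its definition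
    unfolds to \<open>d\<close>.\<close>
  define t where "t = (SOME t. \<gamma> t = proj (\<phi> x))"
  have t: "\<gamma> t = proj (\<phi> x)" unfolding t_def using boundary_on_cylinder[OF xb] by (metis (mono_tags) rangeE someI)
  define d where "d = vector_derivative \<gamma> (at t)"
  have d0: "norm d \<noteq> 0" using derivative_nonzero by (simp add: d_def)
  define \<beta> where "\<beta> = (\<lambda>s. proj (F (\<psi> x + (s, 0))))"
  obtain e where e: "0 < e" "\<And>s. \<bar>s\<bar> < e \<Longrightarrow> \<exists>y \<in> boundary \<inter> topspace S. \<beta> s = proj (\<phi> y)"
    "(\<beta> has_vector_derivative proj (pu F (\<psi> x))) (at 0)" "\<beta> 0 = proj (\<phi> x)"
    using boundary_curve[OF openin_topspace _ p] paramD(6)[OF p(1,2)] unfolding \<beta>_def by metis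
  have "\<beta> s \<in> range \<gamma>" if "\<bar>s\<bar> < e" for s using e(2)[OF that] boundary_on_cylinder by auto
  then obtain a where a: "proj (pu F (\<psi> x)) = a *\<^sub>R d"
    using velocity_parallel[OF e(3) _ e(1), of t] e(4) t unfolding d_def by metis
  have a0: "a \<noteq> 0" using a non_vertical[OF p] by auto
  define X where "X = cross3 (pu F (\<psi> x)) (pv F (\<psi> x))"
  have X0: "norm X \<noteq> 0" using immersion_cross_nonzero[OF paramD(5)[OF p(1,2)] imm[OF p(1,2)]] by (simp add: X_def)
  have pu12: "pu F (\<psi> x) $ 1 = a * d $ 1" "pu F (\<psi> x) $ 2 = a * d $ 2"
    using arg_cong[OF a, of "\<lambda>v. v $ 1"] arg_cong[OF a, of "\<lambda>v. v $ 2"] by simp_all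
  \<comment> \<open>The conormal equals \<open>cross3 X (pu F (\<psi> x))\<close>; its third
    component is minus the product of \<open>X\<close> with the horizontal part of the tangent
    turned by a right angle.\<close>
  have "conormal F (\<psi> x) $ 3 = - (X \<bullet> vector [- (pu F (\<psi> x) $ 2), pu F (\<psi> x) $ 1, 0])"
    by (simp add: conormal_def X_def cross3_def inner_vec_def sum_3 algebra_simps)
  also have "(vector [- (pu F (\<psi> x) $ 2), pu F (\<psi> x) $ 1, 0] :: real^3) = (a * norm d) *\<^sub>R cyl_normal \<gamma> (\<phi> x)"
    unfolding cyl_normal_def Let_def t_def[symmetric] d_def[symmetric] using d0
    by (simp add: vec_eq_iff forall_3 pu12)
  also have "X = norm X *\<^sub>R unit_normal F (\<psi> x)"
    using X0 by (simp add: unit_normal_def X_def)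
  finally have "conormal F (\<psi> x) $ 3 = - (norm X * (a * norm d) * (unit_normal F (\<psi> x) \<bullet> cyl_normal \<gamma> (\<phi> x)))"
    by simp
  then show ?thesis using X0 a0 d0 constant_angle[OF p] by auto
qed

lemma contact_constant:
  assumes le: "\<And>y. y \<in> topspace S \<Longrightarrow> k \<bullet> \<phi> y \<le> M" and ne: "contact k M (topspace S) \<noteq> {}"
    and q: "q \<in> range \<gamma>"
  shows "\<exists>y \<in> boundary. proj (\<phi> y) = q \<and> k \<bullet> \<phi> y = M"
proof -
  note co = contact_clopen[OF openin_topspace closedin_topspace le]
  have "boundary \<inter> contact k M (topspace S) \<noteq> {}" using clopen_meets_boundary[OF co ne] by blast
  then have "(\<lambda>x. proj (\<phi> x)) ` (boundary \<inter> contact k M (topspace S)) = range \<gamma>"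
    using clopen_boundary_part_covers[OF co(1)] closedin_Int[OF closedin_boundary co(2)] by blast
  then have "q \<in> (\<lambda>x. proj (\<phi> x)) ` (boundary \<inter> contact k M (topspace S))" using q by (rule ssubst)
  then show ?thesis using contact_value by auto
qed

text \<open>\<open>clopen_boundary_part_covers\<close> asks for a set open in \<open>S\<close>, so
  the sign condition is extended off the boundary chart by chart; only the trace on the boundary has
  a meaning independent of the chart. Taking \<open>\<sigma>\<close> to be 1 or -1 treats both
  signs.\<close>

lemma conormal_sign_open:
  "\<exists>N. openin S N \<and> boundary \<inter> N = {x \<in> boundary. \<exists>U \<psi> W F. param U \<psi> W F \<and> x \<in> U \<and> \<sigma> * conormal F (\<psi> x) $ 3 < 0}"
proof -
  define V where "V F W = {p \<in> W. \<sigma> * conormal F p $ 3 < 0}" for F :: "real \<times> real \<Rightarrow> real^3" and W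
  define N where "N = \<Union>{{y \<in> U. \<psi> y \<in> V F W} | U \<psi> F W. param U \<psi> W F}"
  have "openin S N" unfolding N_def
  proof (rule openin_Union, clarify)
    fix U \<psi> F W assume p: "param U \<psi> W F"
    note pd = paramD[OF p]
    note s1 = smooth_on_continuous[OF smooth_on_partials(1)[OF pd(2)]]
      smooth_on_continuous[OF smooth_on_partials(2)[OF pd(2)]]
    have "continuous_on W (\<lambda>p. \<sigma> * conormal F p $ 3)"
      unfolding conormal_def by (intro continuous_intros s1)
    then have "open (W \<inter> (\<lambda>p. \<sigma> * conormal F p $ 3) -` {..<0})"
      by (rule continuous_open_preimage[OF _ pd(1)]) simp
    moreover have "W \<inter> (\<lambda>p. \<sigma> * conormal F p $ 3) -` {..<0} = V F W" by (auto simp: V_def)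
    ultimately have "open (V F W)" by simp
    then show "openin S {y \<in> U. \<psi> y \<in> V F W}" by (rule surface_chart_preimage_open[OF chart[OF p]])
  qed
  moreover have "boundary \<inter> N = {x \<in> boundary. \<exists>U \<psi> W F. param U \<psi> W F \<and> x \<in> U \<and> \<sigma> * conormal F (\<psi> x) $ 3 < 0}"
  proof (intro equalityI subsetI)
    fix x assume "x \<in> boundary \<inter> N"
    then show "x \<in> {x \<in> boundary. \<exists>U \<psi> W F. param U \<psi> W F \<and> x \<in> U \<and> \<sigma> * conormal F (\<psi> x) $ 3 < 0}"
      unfolding N_def V_def by blast
  next
    fix x assume "x \<in> {x \<in> boundary. \<exists>U \<psi> W F. param U \<psi> W F \<and> x \<in> U \<and> \<sigma> * conormal F (\<psi> x) $ 3 < 0}"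
    then obtain U \<psi> W F where x: "x \<in> boundary" "x \<in> U" "\<sigma> * conormal F (\<psi> x) $ 3 < 0" and p: "param U \<psi> W F"
      by blast
    then have "x \<in> {y \<in> U. \<psi> y \<in> V F W}" using paramD(3)[OF p x(2)] by (simp add: V_def)
    then show "x \<in> boundary \<inter> N" unfolding N_def using p x(1) by blast
  qed
  ultimately show ?thesis by blast
qed

theorem height_constant: "\<exists>h. \<forall>x \<in> topspace S. \<phi> x $ 3 = h"
proof -
  define e3 :: "real^3" where "e3 = axis 3 1"
  have e3: "e3 \<bullet> v = v $ 3" for v by (simp add: e3_def inner_axis')
  have "boundary \<noteq> {}" using boundary_graph by auto
  then have ne: "topspace S \<noteq> {}" using boundary_subset by auto
  obtain xM where xM: "xM \<in> topspace S" "\<And>y. y \<in> topspace S \<Longrightarrow> e3 \<bullet> \<phi> y \<le> e3 \<bullet> \<phi> xM"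
    using attains_max[OF closedin_topspace ne, of e3] by blast
  obtain xm where xm: "xm \<in> topspace S" "\<And>y. y \<in> topspace S \<Longrightarrow> - e3 \<bullet> \<phi> y \<le> - e3 \<bullet> \<phi> xm"
    using attains_max[OF closedin_topspace ne, of "- e3"] by blast
  define M where "M = \<phi> xM $ 3"
  define m where "m = \<phi> xm $ 3"
  have leM: "e3 \<bullet> \<phi> y \<le> M" if "y \<in> topspace S" for y using xM(2)[OF that] by (simp add: M_def e3)
  have lem: "- e3 \<bullet> \<phi> y \<le> - m" if "y \<in> topspace S" for y using xm(2)[OF that] by (simp add: m_def e3)
  obtain yM where yM: "yM \<in> boundary" "\<phi> yM $ 3 = M"
    using max_attained_on_boundary[OF leM xM(1)] by (auto simp: M_def e3)
  obtain ym where ym: "ym \<in> boundary" "\<phi> ym $ 3 = m"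
    using max_attained_on_boundary[OF lem xm(1)] by (auto simp: m_def e3)
  have "M = m"
  proof (rule ccontr)
    assume Mm: "M \<noteq> m"
    \<comment> \<open>A contact part would carry height \<open>M\<close> over the projection of
      \<open>ym\<close>, where the graph has height \<open>m\<close>.\<close>
    have cM: "contact e3 M (topspace S) = {}"
    proof (rule ccontr)
      assume "contact e3 M (topspace S) \<noteq> {}"
      then obtain y where y: "y \<in> boundary" "proj (\<phi> y) = proj (\<phi> ym)" "e3 \<bullet> \<phi> y = M"
        using contact_constant[OF leM _ boundary_on_cylinder[OF ym(1)]] by blast
      then have "\<phi> y $ 3 = M" by (simp add: e3)
      then show False using boundary_height[OF y(1)] boundary_height[OF ym(1)] y(2) ym(2) Mm by simp
    qed
    have cm: "contact (- e3) (- m) (topspace S) = {}"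
    proof (rule ccontr)
      assume "contact (- e3) (- m) (topspace S) \<noteq> {}"
      then obtain y where y: "y \<in> boundary" "proj (\<phi> y) = proj (\<phi> yM)" "- e3 \<bullet> \<phi> y = - m"
        using contact_constant[OF lem _ boundary_on_cylinder[OF yM(1)]] by blast
      then have "\<phi> y $ 3 = m" by (simp add: e3)
      then show False using boundary_height[OF y(1)] boundary_height[OF yM(1)] y(2) yM(2) Mm by simp
    qed
    have at_max: "conormal F (\<psi> y) $ 3 < 0" if y: "y \<in> boundary" "\<phi> y $ 3 = M" and p: "param U \<psi> W F" "y \<in> U" for y U \<psi> W F
    proof -
      have yt: "y \<in> topspace S" using y boundary_subset by blast
      have "e3 \<bullet> pu F (\<psi> y) = 0" "e3 \<bullet> pv F (\<psi> y) < 0"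
        using contact_alternative[OF openin_topspace yt leM _ p] cM y(2) by (auto simp: e3)
      moreover have "pu F (\<psi> y) \<noteq> 0"
        using immersion_cross_nonzero[OF paramD(5)[OF p] imm[OF p]] by auto
      ultimately show ?thesis by (simp add: conormal_def e3 mult_less_0_iff)
    qed
    have at_min: "0 < conormal F (\<psi> y) $ 3" if y: "y \<in> boundary" "\<phi> y $ 3 = m" and p: "param U \<psi> W F" "y \<in> U" for y U \<psi> W F
    proof -
      have yt: "y \<in> topspace S" using y boundary_subset by blast
      have "- e3 \<bullet> pu F (\<psi> y) = 0" "- e3 \<bullet> pv F (\<psi> y) < 0"
        using contact_alternative[OF openin_topspace yt lem _ p] cm y(2) by (auto simp: e3)
      moreover have "pu F (\<psi> y) \<noteq> 0"
        using immersion_cross_nonzero[OF paramD(5)[OF p] imm[OF p]] by auto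
      ultimately show ?thesis by (simp add: conormal_def e3)
    qed
    \<comment> \<open>The strict sign at one maximum decides the constant, and with it the
      non-vanishing along the whole boundary.\<close>
    have c0: "c \<noteq> 0"
    proof -
      obtain U \<psi> W F where p: "param U \<psi> W F" "yM \<in> U" "snd (\<psi> yM) = 0" using yM(1) by (auto simp: boundary_def)
      show ?thesis using vertical_conormal_eq_0_iff[OF p] at_max[OF yM p(1,2)] by auto
    qed
    define sgn_set where "sgn_set \<sigma> = {x \<in> boundary. \<exists>U \<psi> W F. param U \<psi> W F \<and> x \<in> U \<and> \<sigma> * conormal F (\<psi> x) $ 3 < 0}"
      for \<sigma> :: real
    obtain N1 where N1: "openin S N1" "boundary \<inter> N1 = sgn_set 1"
      using conormal_sign_open[of 1, folded sgn_set_def] by blast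
    obtain N2 where N2: "openin S N2" "boundary \<inter> N2 = sgn_set (-1)"
      using conormal_sign_open[of "-1", folded sgn_set_def] by blast
    have un: "boundary = sgn_set 1 \<union> sgn_set (-1)"
    proof -
      have "x \<in> sgn_set 1 \<union> sgn_set (-1)" if x: "x \<in> boundary" for x
      proof -
        obtain U \<psi> W F where p: "param U \<psi> W F" "x \<in> U" "snd (\<psi> x) = 0" using x by (auto simp: boundary_def)
        then have "conormal F (\<psi> x) $ 3 \<noteq> 0" using vertical_conormal_eq_0_iff[OF p] c0 by simp
        then have "1 * conormal F (\<psi> x) $ 3 < 0 \<or> -1 * conormal F (\<psi> x) $ 3 < 0" by auto
        then show ?thesis using p x unfolding sgn_set_def by blast
      qed
      moreover have "sgn_set \<sigma> \<subseteq> boundary" for \<sigma> by (auto simp: sgn_set_def)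
      ultimately show ?thesis by blast
    qed
    \<comment> \<open>Different charts could give different signs at one point; the positive factor
      between their conormals excludes this.\<close>
    have disj: "sgn_set 1 \<inter> sgn_set (-1) = {}"
    proof (rule ccontr)
      assume "sgn_set 1 \<inter> sgn_set (-1) \<noteq> {}"
      then obtain x U1 \<psi>1 W1 F1 U2 \<psi>2 W2 F2 where x: "x \<in> boundary"
        and p1: "param U1 \<psi>1 W1 F1" "x \<in> U1" and p2: "param U2 \<psi>2 W2 F2" "x \<in> U2"
        and s: "conormal F1 (\<psi>1 x) $ 3 < 0" "0 < conormal F2 (\<psi>2 x) $ 3"
        unfolding sgn_set_def by auto
      obtain k where "0 < k" "conormal F1 (\<psi>1 x) = k *\<^sub>R conormal F2 (\<psi>2 x)"
        using conormal_chart_independent[OF p1 p2 x] by blast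
      then show False using s by (simp add: mult_less_0_iff)
    qed
    \<comment> \<open>The two open sign sets partition the boundary, so each is closed as the
      complement of the other.\<close>
    have "boundary \<inter> N1 = boundary \<inter> (topspace S - N2)" using N1(2) N2(2) un disj boundary_subset by blast
    moreover have "closedin S (boundary \<inter> (topspace S - N2))"
      using N2(1) by (intro closedin_Int closedin_boundary) auto
    ultimately have cl: "closedin S (boundary \<inter> N1)" by simp
    have "yM \<in> boundary \<inter> N1"
    proof -
      obtain U \<psi> W F where p: "param U \<psi> W F" "yM \<in> U" using yM(1) by (auto simp: boundary_def)
      then show ?thesis unfolding N1(2) sgn_set_def using at_max[OF yM p] yM(1) by auto
    qed
    then have "(\<lambda>x. proj (\<phi> x)) ` (boundary \<inter> N1) = range \<gamma>"
      using clopen_boundary_part_covers[OF N1(1) cl] by blast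
    then have "proj (\<phi> ym) \<in> (\<lambda>x. proj (\<phi> x)) ` (boundary \<inter> N1)"
      using boundary_on_cylinder[OF ym(1)] by (rule ssubst)
    then obtain y where y: "y \<in> boundary" "y \<in> sgn_set 1" "proj (\<phi> y) = proj (\<phi> ym)"
      using N1(2) by (elim imageE) (metis IntE)
    have ym': "\<phi> y $ 3 = m" using boundary_height[OF y(1)] boundary_height[OF ym(1)] y(3) ym(2) by simp
    obtain U \<psi> W F where p: "param U \<psi> W F" "y \<in> U" "conormal F (\<psi> y) $ 3 < 0"
      using y(2) unfolding sgn_set_def by auto
    then show False using at_min[OF y(1) ym' p(1,2)] by simp
  qed
  then have "\<phi> x $ 3 = M" if "x \<in> topspace S" for x
    using leM[OF that] lem[OF that] by (simp add: e3)
  then show ?thesis by blast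
qed

end

theorem theorem2p6:
  fixes \<gamma> :: "real \<Rightarrow> real^2" and C \<Omega> :: "(real^2) set"
    and S :: "'a topology" and A :: "('a set \<times> ('a \<Rightarrow> real \<times> real)) set"
    and \<phi> :: "'a \<Rightarrow> real^3" and c :: real and bdS :: "'a set"
  assumes curve: "smooth_simple_closed_curve \<gamma>"
    and C_def: "C = \<gamma> ` {0..1}"
    and Omega_def: "\<Omega> = inside C"
    and Haus: "Hausdorff_space S"
    and cpt: "compact_space S"
    and charts: "\<forall>(U, \<psi>) \<in> A. surface_chart S U \<psi>"
    and cover: "\<forall>x \<in> topspace S. \<exists>(U, \<psi>) \<in> A. x \<in> U"
    and bdS_def: "bdS = {x. \<exists>(U, \<psi>) \<in> A. x \<in> U \<and> snd (\<psi> x) = 0}"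
    and minimal_immersion:
      "\<forall>(U, \<psi>) \<in> A. \<exists>W F. local_rep \<phi> U \<psi> W F \<and>
          (\<forall>x \<in> U. inj (frechet_derivative F (at (\<psi> x))) \<and> mean_curvature F (\<psi> x) = 0) \<and>
          (\<forall>x \<in> U. snd (\<psi> x) = 0 \<longrightarrow>
              \<bar>unit_normal F (\<psi> x) \<bullet> cyl_normal \<gamma> (\<phi> x)\<bar> = c \<and> proj (pu F (\<psi> x)) \<noteq> 0)"
    and in_K: "\<phi> ` topspace S \<subseteq> {q. proj q \<in> \<Omega> \<union> C}"
    and bd_in_Sigma: "\<phi> ` bdS \<subseteq> {q. proj q \<in> C}"
    and graph: "\<exists>f :: real^2 \<Rightarrow> real. \<phi> ` bdS = {lift p (f p) | p. p \<in> C}"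
  shows "\<exists>h. \<forall>x \<in> topspace S. \<phi> x $ 3 = h"
proof -
  define param where "param U \<psi> W F \<longleftrightarrow> (U, \<psi>) \<in> A \<and> local_rep \<phi> U \<psi> W F \<and>
          (\<forall>x \<in> U. inj (frechet_derivative F (at (\<psi> x))) \<and> mean_curvature F (\<psi> x) = 0) \<and>
          (\<forall>x \<in> U. snd (\<psi> x) = 0 \<longrightarrow>
              \<bar>unit_normal F (\<psi> x) \<bullet> cyl_normal \<gamma> (\<phi> x)\<bar> = c \<and> proj (pu F (\<psi> x)) \<noteq> 0)" for U \<psi> W F
  have ex_param: "\<exists>W F. param U \<psi> W F" if "(U, \<psi>) \<in> A" for U \<psi>
    unfolding param_def using bspec[OF minimal_immersion that] that by auto
  interpret cc: closed_curve \<gamma> by unfold_locales (rule curve)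
  have C: "C = range \<gamma>" using C_def cc.image_unit_interval by simp
  interpret ms: minimal_surface S \<phi> param
  proof
    show "compact_space S" by (rule cpt)
    show "surface_chart S U \<psi>" if "param U \<psi> W F" for U \<psi> W F
      using charts that by (auto simp: param_def)
    show "\<exists>U \<psi> W F. param U \<psi> W F \<and> x \<in> U" if x: "x \<in> topspace S" for x
    proof -
      obtain U \<psi> where "(U, \<psi>) \<in> A" "x \<in> U" using cover x by fastforce
      then show ?thesis using ex_param by blast
    qed
  qed (auto simp: param_def)
  have bd: "ms.boundary = bdS"
  proof (intro equalityI subsetI)
    fix x assume "x \<in> ms.boundary"
    then obtain U \<psi> W F where "param U \<psi> W F" "x \<in> U" "snd (\<psi> x) = 0" unfolding ms.boundary_def by blast
    then show "x \<in> bdS" unfolding bdS_def param_def by blast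
  next
    fix x assume "x \<in> bdS"
    then obtain U \<psi> where "(U, \<psi>) \<in> A" "x \<in> U" "snd (\<psi> x) = 0" unfolding bdS_def by blast
    then show "x \<in> ms.boundary" unfolding ms.boundary_def using ex_param by blast
  qed
  obtain f where f: "\<phi> ` bdS = {lift p (f p) | p. p \<in> C}" using graph by blast
  interpret cylinder_surface S \<phi> param \<gamma> f c
  proof
    show "proj (\<phi> x) \<in> range \<gamma>" if "x \<in> ms.boundary" for x using bd_in_Sigma that bd C by auto
    show "\<phi> ` ms.boundary = {lift p (f p) | p. p \<in> range \<gamma>}" using f bd C by simp
  qed (auto simp: param_def)
  show ?thesis by (rule height_constant)
qed

end
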